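(* If $\ell=1$, then $$\operatorname{Sc}(V_{\widehat{\mathfrak{sl}}_2}(\ell,0),\omega)=\operatorname{Sc}(L_{\widehat{\mathfrak{sl}}_2}(\ell,0),\omega)=\{\omega,0\}.$$
   Context: On $\mathfrak{sl}_2=\mathfrak{sl}_2(\mathbb{C})$ with standard basis $h,e,f$ use the normalized Killing form $\langle h,h\rangle=2$, $\langle e,f\rangle=1$, all other pairings of basis elements being $0$. An orthonormal basis is $\alpha_1=\frac{e+f}{\sqrt2}$, $\alpha_2=\frac{e-f}{\sqrt{-2}}$, $\alpha_3=\frac{h}{\sqrt2}$. $\widehat{\mathfrak{sl}}_2=\mathfrak{sl}_2\otimes\mathbb{C}[t,t^{-1}]\oplus\mathbb{C}K$, $a(n)=a\otimes t^n$, $[a(n),b(m)]=[a,b](n+m)+n\delta_{n+m,0}\langle a,b\rangle K$, $K$ central. $V_{\widehat{\mathfrak{sl}}_2}(\ell,0)$ is the universal affine vertex operator algebra of level $\ell\ne-2$ (induced from the one-dimensional module $\mathbb{C}\mathbf{1}$ of $\mathfrak{sl}_2\otimes\mathbb{C}[t]\oplus\mathbb{C}K$ on which $\mathfrak{sl}_2\otimes\mathbb{C}[t]$ acts by $0$ and $K$ by $\ell$), with conformal vector $\omega=\frac{1}{2(\ell+2)}\sum_{i=1}^3\alpha_i(-1)^2\mathbf{1}$; $L_{\widehat{\mathfrak{sl}}_2}(\ell,0)$ is its simple quotient, with conformal vector the image of $\omega$, again denoted $\omega$. (The equality between the two sets is understood through the quotient map.) For a vertex operator algebra $(V,\omega)$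 write $Y(v,z)=\sum_n v_nz^{-n-1}$. A vector $\omega'\in V$ is semi-conformal if there is a vertex subalgebra $U\subseteq V$ such that $(U,\omega')$ is a vertex operator algebra with conformal vector $\omega'$ and $\omega'_n|_U=\omega_n|_U$ for all $n\ge0$; $\operatorname{Sc}(V,\omega)$ is the set of semi-conformal vectors. *)

theory Defs
  imports "HOL-Analysis.Analysis" "HOL-Library.Poly_Mapping" "HOL-Library.Groups_Big_Fun"
begin

section \<open>Vertex algebras\<close>

text \<open>
  \<open>Y u n v\<close> is the mode $u_n v$, where $Y(u,z) = \sum_n u_n z^{-n-1}$.  The axiom \<open>borcherds\<close> is the
  Jacobi identity written in components.  By \<open>truncation\<close> all its sums have finitely many nonzero
  terms, so \<open>Sum_any\<close> is their actual value.
\<close>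

locale vertex_algebra = vector_space scale
  for scale :: "complex \<Rightarrow> 'v::ab_group_add \<Rightarrow> 'v" +
  fixes Y :: "'v \<Rightarrow> int \<Rightarrow> 'v \<Rightarrow> 'v" and vac :: 'v
  assumes Y_add_left: "Y (u + u') n v = Y u n v + Y u' n v"
    and Y_scale_left: "Y (scale c u) n v = scale c (Y u n v)"
    and Y_add_right: "Y u n (v + v') = Y u n v + Y u n v'"
    and Y_scale_right: "Y u n (scale c v) = scale c (Y u n v)"
    and truncation: "\<exists>N. \<forall>n\<ge>N. Y u n v = 0"
    and vacuum: "Y vac n v = (if n = -1 then v else 0)"
    and creation: "Y v (-1) vac = v" "n \<ge> 0 \<Longrightarrow> Y v n vac = 0"
    and borcherds:
      "Sum_any (\<lambda>i::nat. scale ((-1) ^ i * ((of_int l :: complex) gchoose i))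
          (Y u (l + m - int i) (Y v (n + int i) w)
           - scale ((-1) powi l) (Y v (l + n - int i) (Y u (m + int i) w))))
       = Sum_any (\<lambda>i::nat. scale ((of_int m :: complex) gchoose i)
          (Y (Y u (l + int i) v) (m + n - int i) w))"
begin

definition vertex_subalgebra :: "'v set \<Rightarrow> bool" where
  "vertex_subalgebra U \<longleftrightarrow>
     subspace U \<and> vac \<in> U \<and> (\<forall>u\<in>U. \<forall>v\<in>U. \<forall>n. Y u n v \<in> U)"

definition vir :: "'v \<Rightarrow> int \<Rightarrow> 'v \<Rightarrow> 'v" where
  "vir \<omega> n = Y \<omega> (n + 1)"

definition weight_space :: "'v set \<Rightarrow> 'v \<Rightarrow> int \<Rightarrow> 'v set" where
  "weight_space U \<omega> n = {u \<in> U. vir \<omega> 0 u = scale (of_int n) u}"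

text \<open>
  \<open>voa_on U \<omega>\<close>: the vertex subalgebra \<open>U\<close>, with the restricted operations, is a vertex operator
  algebra with conformal vector \<open>\<omega>\<close>.  The sum of the weight spaces is automatically direct, being a
  sum of eigenspaces.  \<open>U\<close> itself carries the vertex algebra axioms by restriction, and for
  \<open>U = UNIV\<close> this says that the whole algebra is a vertex operator algebra.
\<close>

definition voa_on :: "'v set \<Rightarrow> 'v \<Rightarrow> bool" where
  "voa_on U \<omega> \<longleftrightarrow>
     vertex_subalgebra U \<and> \<omega> \<in> U \<and>
     (\<exists>c. \<forall>m n. \<forall>u\<in>U.
        vir \<omega> m (vir \<omega> n u) - vir \<omega> n (vir \<omega> m u)
        = scale (of_int (m - n)) (vir \<omega> (m + n) u)
          + (if m + n = 0 then scale (of_int (m ^ 3 - m) / 12 * c) u else 0)) \<and>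
     (\<forall>u\<in>U. vir \<omega> (-1) u = Y u (-2) vac) \<and>
     U = span (\<Union>n. weight_space U \<omega> n) \<and>
     (\<forall>n. \<exists>B. finite B \<and> weight_space U \<omega> n = span B) \<and>
     (\<exists>N. \<forall>n<N. weight_space U \<omega> n = {0})"

definition Sc :: "'v \<Rightarrow> 'v set" where
  "Sc \<omega> = {\<omega>'. \<exists>U. voa_on U \<omega>' \<and> (\<forall>n\<ge>0. \<forall>u\<in>U. Y \<omega>' n u = Y \<omega> n u)}"

definition va_ideal :: "'v set \<Rightarrow> bool" where
  "va_ideal I \<longleftrightarrow> subspace I \<and> (\<forall>v. \<forall>w\<in>I. \<forall>n. Y v n w \<in> I \<and> Y w n v \<in> I)"

definition simple_va :: bool where
  "simple_va \<longleftrightarrow> (\<exists>v::'v. v \<noteq> 0) \<and> (\<forall>I. va_ideal I \<longrightarrow> I = {0} \<or> I = UNIV)"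

end

definition va_hom ::
  "(complex \<Rightarrow> 'v::ab_group_add \<Rightarrow> 'v) \<Rightarrow> ('v \<Rightarrow> int \<Rightarrow> 'v \<Rightarrow> 'v) \<Rightarrow> 'v \<Rightarrow>
   (complex \<Rightarrow> 'w::ab_group_add \<Rightarrow> 'w) \<Rightarrow> ('w \<Rightarrow> int \<Rightarrow> 'w \<Rightarrow> 'w) \<Rightarrow> 'w \<Rightarrow> ('v \<Rightarrow> 'w) \<Rightarrow> bool" where
  "va_hom s Y vac s' Y' vac' \<pi> \<longleftrightarrow>
     Vector_Spaces.linear s s' \<pi> \<and> \<pi> vac = vac' \<and> (\<forall>u n v. \<pi> (Y u n v) = Y' (\<pi> u) n (\<pi> v))"

text \<open>
  A simple quotient is presented by its quotient map: \<open>s' Y' vac'\<close> is identified with the quotient of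
  \<open>s Y vac\<close> by the ideal \<open>{v. \<pi> v = 0}\<close>.
\<close>

definition simple_quotient_map ::
  "(complex \<Rightarrow> 'v::ab_group_add \<Rightarrow> 'v) \<Rightarrow> ('v \<Rightarrow> int \<Rightarrow> 'v \<Rightarrow> 'v) \<Rightarrow> 'v \<Rightarrow>
   (complex \<Rightarrow> 'w::ab_group_add \<Rightarrow> 'w) \<Rightarrow> ('w \<Rightarrow> int \<Rightarrow> 'w \<Rightarrow> 'w) \<Rightarrow> 'w \<Rightarrow> ('v \<Rightarrow> 'w) \<Rightarrow> bool" where
  "simple_quotient_map s Y vac s' Y' vac' \<pi> \<longleftrightarrow>
     vertex_algebra s' Y' vac' \<and> vertex_algebra.simple_va s' Y' \<and>
     va_hom s Y vac s' Y' vac' \<pi> \<and> surj \<pi>"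


section \<open>The affine Lie algebra of type $A_1^{(1)}$\<close>

type_synonym cmat2 = "complex^2^2"

definition smat :: "complex \<Rightarrow> cmat2 \<Rightarrow> cmat2" where
  "smat c A = (\<chi> i j. c * A $ i $ j)"

definition sl2 :: "cmat2 set" where
  "sl2 = {A. trace A = 0}"

definition lie :: "cmat2 \<Rightarrow> cmat2 \<Rightarrow> cmat2" where
  "lie A B = A ** B - B ** A"

text \<open>The normalized Killing form of $\mathfrak{sl}_2$ is the trace form; see \<open>sl2_form\<close> below.\<close>

definition form :: "cmat2 \<Rightarrow> cmat2 \<Rightarrow> complex" where
  "form A B = trace (A ** B)"

definition sl2_h :: cmat2 where "sl2_h = vector [vector [1, 0], vector [0, -1]]"
definition sl2_e :: cmat2 where "sl2_e = vector [vector [0, 1], vector [0, 0]]"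
definition sl2_f :: cmat2 where "sl2_f = vector [vector [0, 0], vector [1, 0]]"

lemma sl2_mem: "sl2_h \<in> sl2" "sl2_e \<in> sl2" "sl2_f \<in> sl2"
  by (simp_all add: sl2_def trace_def sl2_h_def sl2_e_def sl2_f_def sum_2 vector_2)

lemma sl2_lie:
  "lie sl2_h sl2_e = smat 2 sl2_e" "lie sl2_h sl2_f = smat (-2) sl2_f" "lie sl2_e sl2_f = sl2_h"
  by (simp_all add: lie_def smat_def matrix_matrix_mult_def vec_eq_iff forall_2 sum_2
        sl2_h_def sl2_e_def sl2_f_def vector_2)

lemma sl2_form:
  "form sl2_h sl2_h = 2" "form sl2_e sl2_f = 1" "form sl2_f sl2_e = 1"
  "form sl2_e sl2_e = 0" "form sl2_f sl2_f = 0" "form sl2_h sl2_e = 0" "form sl2_h sl2_f = 0"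
  "form sl2_e sl2_h = 0" "form sl2_f sl2_h = 0"
  by (simp_all add: form_def trace_def matrix_matrix_mult_def sum_2
        sl2_h_def sl2_e_def sl2_f_def vector_2)

text \<open>
  An element $\sum_n p_n \otimes t^n + k K$ of the affine algebra is the pair \<open>(p, k)\<close>, where \<open>p\<close> is a
  finitely supported function with values in \<open>sl2\<close>.  The type also contains pairs with values outside
  \<open>sl2\<close>; the Lie algebra is the set \<open>affine_sl2\<close>.
\<close>

type_synonym affine = "(int \<Rightarrow>\<^sub>0 cmat2) \<times> complex"

definition affine_sl2 :: "affine set" where
  "affine_sl2 = {(p, k). \<forall>n. Poly_Mapping.lookup p n \<in> sl2}"

definition affine_scale :: "complex \<Rightarrow> affine \<Rightarrow> affine" where
  "affine_scale c x = (Poly_Mapping.map (smat c) (fst x), c * snd x)"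

definition affine_bracket :: "affine \<Rightarrow> affine \<Rightarrow> affine" where
  "affine_bracket x y =
     (\<Sum>m\<in>Poly_Mapping.keys (fst x). \<Sum>n\<in>Poly_Mapping.keys (fst y).
        (let a = Poly_Mapping.lookup (fst x) m; b = Poly_Mapping.lookup (fst y) n
         in (Poly_Mapping.single (m + n) (lie a b),
             if m + n = 0 then of_int m * form a b else 0)))"

definition loop :: "cmat2 \<Rightarrow> int \<Rightarrow> affine" where
  "loop a n = (Poly_Mapping.single n a, 0)"

text \<open>The subalgebra $\mathfrak{sl}_2 \otimes \mathbb{C}[t] \oplus \mathbb{C}K$.\<close>

definition affine_nonneg :: "affine set" where
  "affine_nonneg = {(p, k) \<in> affine_sl2. \<forall>n<0. Poly_Mapping.lookup p n = 0}"

definition affine_rep :: "(complex \<Rightarrow> 'v::ab_group_add \<Rightarrow> 'v) \<Rightarrow> (affine \<Rightarrow> 'v \<Rightarrow> 'v) \<Rightarrow> bool" where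
  "affine_rep s \<rho> \<longleftrightarrow>
     (\<forall>x\<in>affine_sl2. Vector_Spaces.linear s s (\<rho> x)) \<and>
     (\<forall>x\<in>affine_sl2. \<forall>y\<in>affine_sl2. \<forall>v. \<rho> (x + y) v = \<rho> x v + \<rho> y v) \<and>
     (\<forall>c. \<forall>x\<in>affine_sl2. \<forall>v. \<rho> (affine_scale c x) v = s c (\<rho> x v)) \<and>
     (\<forall>x\<in>affine_sl2. \<forall>y\<in>affine_sl2. \<forall>v.
        \<rho> (affine_bracket x y) v = \<rho> x (\<rho> y v) - \<rho> y (\<rho> x v))"


section \<open>Induced modules and the universal affine vertex algebra\<close>

text \<open>
  Write $\mathfrak{g}$ for \<open>affine_sl2\<close>, $\mathfrak{p}$ for \<open>affine_nonneg\<close> and $\chi$ for the character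
  \<open>(p, k) \<mapsto> level * k\<close> of $\mathfrak{p}$.  The induced module
  $U(\mathfrak{g}) \otimes_{U(\mathfrak{p})} \mathbb{C}_\chi$ is the quotient of $U(\mathfrak{g})$ by
  its left ideal generated by all $x - \chi(x)$ with $x \in \mathfrak{p}$.  Presenting
  $U(\mathfrak{g})$ itself as the free associative algebra on the set $\mathfrak{g}$ modulo the
  relations making $\mathfrak{g} \to U(\mathfrak{g})$ a linear map that takes brackets to commutators,
  the induced module is the free vector space on words with letters in $\mathfrak{g}$ modulo the span
  of \<open>induced_relations\<close>.
\<close>

definition wmon :: "affine list \<Rightarrow> affine list \<Rightarrow>\<^sub>0 complex" where
  "wmon w = Poly_Mapping.single w 1"

definition free_scale ::
  "complex \<Rightarrow> (affine list \<Rightarrow>\<^sub>0 complex) \<Rightarrow> (affine list \<Rightarrow>\<^sub>0 complex)" where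
  "free_scale c = Poly_Mapping.map ((*) c)"

definition free_words :: "(affine list \<Rightarrow>\<^sub>0 complex) set" where
  "free_words = {F. \<forall>w\<in>Poly_Mapping.keys F. set w \<subseteq> affine_sl2}"

definition induced_relations :: "complex \<Rightarrow> (affine list \<Rightarrow>\<^sub>0 complex) set" where
  "induced_relations level =
     {wmon (u @ [x + y] @ w) - wmon (u @ [x] @ w) - wmon (u @ [y] @ w) | u x y w.
        set u \<subseteq> affine_sl2 \<and> set w \<subseteq> affine_sl2 \<and> x \<in> affine_sl2 \<and> y \<in> affine_sl2} \<union>
     {wmon (u @ [affine_scale c x] @ w) - free_scale c (wmon (u @ [x] @ w)) | u c x w.
        set u \<subseteq> affine_sl2 \<and> set w \<subseteq> affine_sl2 \<and> x \<in> affine_sl2} \<union>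
     {wmon (u @ [x, y] @ w) - wmon (u @ [y, x] @ w) - wmon (u @ [affine_bracket x y] @ w) | u x y w.
        set u \<subseteq> affine_sl2 \<and> set w \<subseteq> affine_sl2 \<and> x \<in> affine_sl2 \<and> y \<in> affine_sl2} \<union>
     {wmon (u @ [x]) - free_scale (level * snd x) (wmon u) | u x.
        set u \<subseteq> affine_sl2 \<and> x \<in> affine_nonneg}"

text \<open>The word $x_1 \cdots x_k$ is sent to $\rho(x_1) \cdots \rho(x_k) v_0$.\<close>

definition word_action ::
  "(complex \<Rightarrow> 'v::ab_group_add \<Rightarrow> 'v) \<Rightarrow> (affine \<Rightarrow> 'v \<Rightarrow> 'v) \<Rightarrow> 'v \<Rightarrow>
   (affine list \<Rightarrow>\<^sub>0 complex) \<Rightarrow> 'v" where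
  "word_action s \<rho> v0 F =
     (\<Sum>w\<in>Poly_Mapping.keys F. s (Poly_Mapping.lookup F w) (foldr \<rho> w v0))"

definition induced_module ::
  "complex \<Rightarrow> (complex \<Rightarrow> 'v::ab_group_add \<Rightarrow> 'v) \<Rightarrow> (affine \<Rightarrow> 'v \<Rightarrow> 'v) \<Rightarrow> 'v \<Rightarrow> bool" where
  "induced_module level s \<rho> v0 \<longleftrightarrow>
     affine_rep s \<rho> \<and>
     word_action s \<rho> v0 ` free_words = UNIV \<and>
     {F \<in> free_words. word_action s \<rho> v0 F = 0} = module.span free_scale (induced_relations level)"

text \<open>
  The vertex algebra structure of level \<open>level\<close> on the induced module is the one with
  $\mathbf{1} = 1 \otimes 1$ and $Y(a(-1)\mathbf{1}, z) = \sum_n a(n) z^{-n-1}$ for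
  $a \in \mathfrak{sl}_2$; these conditions determine it uniquely.
\<close>

definition universal_affine_sl2 ::
  "complex \<Rightarrow> (complex \<Rightarrow> 'v::ab_group_add \<Rightarrow> 'v) \<Rightarrow> ('v \<Rightarrow> int \<Rightarrow> 'v \<Rightarrow> 'v) \<Rightarrow> 'v \<Rightarrow>
   (affine \<Rightarrow> 'v \<Rightarrow> 'v) \<Rightarrow> bool" where
  "universal_affine_sl2 level s Y vac \<rho> \<longleftrightarrow>
     vertex_algebra s Y vac \<and>
     induced_module level s \<rho> vac \<and>
     (\<forall>a\<in>sl2. \<forall>n v. Y (\<rho> (loop a (-1)) vac) n v = \<rho> (loop a n) v)"

definition sl2_onb :: "cmat2 list" where
  "sl2_onb = [smat (1 / csqrt 2) (sl2_e + sl2_f),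
              smat (1 / csqrt (-2)) (sl2_e - sl2_f),
              smat (1 / csqrt 2) sl2_h]"

lemma sl2_onb_orthonormal:
  assumes "i < 3" "j < 3"
  shows "sl2_onb ! i \<in> sl2" "form (sl2_onb ! i) (sl2_onb ! j) = (if i = j then 1 else 0)"
proof -
  have c: "csqrt 2 * csqrt 2 = 2" "csqrt (-2) * csqrt (-2) = -2"
      "complex_of_real (sqrt 2) * complex_of_real (sqrt 2) = 2"
    by (metis power2_csqrt power2_eq_square, metis power2_csqrt power2_eq_square,
        simp flip: of_real_mult)
  have "i = 0 \<or> i = 1 \<or> i = 2" "j = 0 \<or> j = 1 \<or> j = 2" using assms by auto
  then show "sl2_onb ! i \<in> sl2" "form (sl2_onb ! i) (sl2_onb ! j) = (if i = j then 1 else 0)"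
    by (auto simp: field_simps sl2_onb_def sl2_def form_def smat_def trace_def matrix_matrix_mult_def sum_2
          sl2_h_def sl2_e_def sl2_f_def vector_2 c)
qed

definition sugawara ::
  "complex \<Rightarrow> (complex \<Rightarrow> 'v::ab_group_add \<Rightarrow> 'v) \<Rightarrow> 'v \<Rightarrow> (affine \<Rightarrow> 'v \<Rightarrow> 'v) \<Rightarrow> 'v" where
  "sugawara level s vac \<rho> =
     s (1 / (2 * (level + 2)))
       (\<Sum>a\<leftarrow>sl2_onb. \<rho> (loop a (-1)) (\<rho> (loop a (-1)) vac))"

end

theory Submission
  imports Defs
begin

text \<open>
  Let \<open>W\<close> be a vertex algebra generated by \<open>e\<close>, \<open>f\<close>, \<open>h\<close> with the operator products of
  $\widehat{\mathfrak{sl}}_2$ at level 1; both the universal algebra and its simple quotient are of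
  this kind.  A semi-conformal vector \<open>x\<close> of \<open>W\<close> satisfies $L(0)x = 2x$, $L(1)x = 0$ and
  $x_1 x = 2x$.  The vector $e(-1)^2\mathbf{1}$ is singular, so it generates an ideal living in
  weights $\ge 2$ and vanishes when \<open>W\<close> is simple.  Applying $f(0)$ repeatedly to
  $e(-1)^2\mathbf{1} = 0$ shows that the weight 2 space is then spanned by \<open>\<omega>\<close> and the
  $a(-2)\mathbf{1}$.  Now $L(1)x = 0$ forces $x = c\,\omega$, and $x_1 x = 2x$ forces
  $c^2 \omega = c\,\omega$.  The three equations pass along the quotient map, so the semi-conformal
  vectors of the universal algebra need no separate classification.
\<close>

section \<open>Vertex algebras\<close>

text \<open>Upper negation; these are the coefficients that \<open>iterate\<close> produces for the
  product \<open>Y v (-2) vac\<close>.\<close>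

lemma gchoose_minus2: "(-1) ^ i * ((-2::complex) gchoose i) = of_nat (i + 1)"
proof -
  have "(-2::complex) gchoose i = (-1)^i * ((2 + of_nat i - 1) gchoose i)"
    using gbinomial_minus[of "2::complex" i] by simp
  also have "(2 + of_nat i - 1 :: complex) = of_nat (Suc i)" by simp
  also have "of_nat (Suc i) gchoose i = (of_nat (Suc i choose i) :: complex)"
    by (simp only: binomial_gbinomial)
  finally show ?thesis by simp
qed

lemma Sum_any_single:
  assumes "\<And>i. i \<noteq> k \<Longrightarrow> g i = 0"
  shows "Sum_any g = (g k :: 'b::comm_monoid_add)"
proof -
  have "Sum_any g = sum g {k}"
    using assms by (intro Sum_any.expand_superset) auto
  then show ?thesis by simp
qed

lemma Sum_any_upto:
  assumes "\<And>i::nat. i \<ge> n \<Longrightarrow> g i = 0"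
  shows "Sum_any g = (\<Sum>i<n. g i :: 'b::comm_monoid_add)"
proof -
  have "{i. g i \<noteq> 0} \<subseteq> {..<n}" using assms not_le by auto
  then show ?thesis by (intro Sum_any.expand_superset) auto
qed

lemma gchoose_0: "(0::complex) gchoose i = (if i = 0 then 1 else 0)"
  by (cases i) auto

context vertex_algebra
begin

section \<open>Linearity of the modes; commutator and iterate formulas\<close>

lemma scale_2: "scale 2 x = x + x"
  by (metis one_add_one scale_left_distrib scale_one)

lemma Y_zero_left [simp]: "Y 0 n v = 0"
  using Y_scale_left[of 0 0 n v] by simp

lemma Y_zero_right [simp]: "Y u n 0 = 0"
  using Y_scale_right[of u n 0 0] by simp

lemma Y_minus_left: "Y (- u) n v = - Y u n v"
  using Y_scale_left[of "-1" u n v] by simp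

lemma Y_minus_right: "Y u n (- v) = - Y u n v"
  using Y_scale_right[of u n "-1" v] by simp

lemma Y_diff_left: "Y (u - u') n v = Y u n v - Y u' n v"
  by (simp only: diff_conv_add_uminus Y_add_left Y_minus_left)

lemma Y_diff_right: "Y u n (v - v') = Y u n v - Y u n v'"
  by (simp only: diff_conv_add_uminus Y_add_right Y_minus_right)

lemmas Y_linear = Y_add_left Y_scale_left Y_minus_left Y_diff_left
  Y_add_right Y_scale_right Y_minus_right Y_diff_right

lemma Y_sum_right: "Y u n (sum g A) = (\<Sum>i\<in>A. Y u n (g i))"
  by (induction A rule: infinite_finite_induct) (auto simp: Y_add_right)

lemma Y_span_right:
  assumes "x \<in> span A" "subspace B" "\<And>x. x \<in> A \<Longrightarrow> Y u n x \<in> B"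
  shows "Y u n x \<in> B"
  using assms(1)
proof (induction rule: span_induct)
  show "subspace {x. Y u n x \<in> B}"
    using assms(2) by (auto simp: subspace_def Y_linear)
qed (use assms(3) in auto)

text \<open>Infinite support is harmless, since \<open>Sum_any\<close> is then 0, which lies in
  every subspace.\<close>

lemma Sum_any_in_subspace:
  assumes "subspace S" "\<And>i. g i \<in> S"
  shows "Sum_any g \<in> S"
  unfolding Sum_any.expand_set using assms by (intro subspace_sum) auto

text \<open>At \<open>l = 0\<close> the left side of the Jacobi identity collapses to its term
  \<open>i = 0\<close>.\<close>

lemma commutator:
  "Y u m (Y v n w) - Y v n (Y u m w)
     = Sum_any (\<lambda>i::nat. scale ((of_int m :: complex) gchoose i) (Y (Y u (int i) v) (m + n - int i) w))"
proof -
  let ?g = "\<lambda>i::nat. scale ((-1) ^ i * ((of_int 0 :: complex) gchoose i))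
          (Y u (0 + m - int i) (Y v (n + int i) w)
           - scale ((-1) powi 0) (Y v (0 + n - int i) (Y u (m + int i) w)))"
  have "Sum_any ?g = ?g 0"
    by (rule Sum_any_single) (auto simp: gchoose_0)
  moreover have "Sum_any ?g = Sum_any (\<lambda>i::nat. scale ((of_int m :: complex) gchoose i)
      (Y (Y u (0 + int i) v) (m + n - int i) w))"
    by (rule borcherds)
  ultimately have "?g 0 = Sum_any (\<lambda>i::nat. scale ((of_int m :: complex) gchoose i)
      (Y (Y u (0 + int i) v) (m + n - int i) w))" by (rule trans[OF sym])
  then show ?thesis by simp
qed

lemma commutator_upto:
  assumes "\<And>i. i \<ge> N \<Longrightarrow> Y u (int i) v = 0"
  shows "Y u m (Y v n w) - Y v n (Y u m w)
     = (\<Sum>i<N. scale ((of_int m :: complex) gchoose i) (Y (Y u (int i) v) (m + n - int i) w))"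
  unfolding commutator by (rule Sum_any_upto) (simp add: assms)

text \<open>At \<open>m = 0\<close> the right side of the Jacobi identity collapses to its term
  \<open>i = 0\<close>.\<close>

lemma iterate:
  "Y (Y u l v) n w = Sum_any (\<lambda>i::nat. scale ((-1) ^ i * ((of_int l :: complex) gchoose i))
          (Y u (l - int i) (Y v (n + int i) w)
           - scale ((-1) powi l) (Y v (l + n - int i) (Y u (int i) w))))"
proof -
  let ?g = "\<lambda>i::nat. scale ((of_int 0 :: complex) gchoose i)
          (Y (Y u (l + int i) v) (0 + n - int i) w)"
  have "Sum_any ?g = ?g 0"
    by (rule Sum_any_single) (auto simp: gchoose_0)
  moreover have "Sum_any (\<lambda>i::nat. scale ((-1) ^ i * ((of_int l :: complex) gchoose i))
          (Y u (l + 0 - int i) (Y v (n + int i) w)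
           - scale ((-1) powi l) (Y v (l + n - int i) (Y u (0 + int i) w)))) = Sum_any ?g"
    by (rule borcherds)
  ultimately have "Sum_any (\<lambda>i::nat. scale ((-1) ^ i * ((of_int l :: complex) gchoose i))
          (Y u (l + 0 - int i) (Y v (n + int i) w)
           - scale ((-1) powi l) (Y v (l + n - int i) (Y u (0 + int i) w)))) = ?g 0"
    by (rule trans[rotated])
  then show ?thesis by (simp only: add_0 add_0_right) simp
qed

section \<open>The translation operator\<close>

definition T :: "'v \<Rightarrow> 'v" where "T v = Y v (-2) vac"

lemma T_vac: "T vac = 0"
  by (simp add: T_def vacuum)

text \<open>In the iterate formula on the vacuum, creation kills every term except
  \<open>i = 0\<close>, which gives \<open>T v\<close>, and \<open>i = 1\<close>, which gives
  \<open>v\<close> itself.\<close>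

lemma T_Y: "T (Y u n v) = Y u n (T v) - scale (of_int n) (Y u (n - 1) v)"
proof -
  have "T (Y u n v) = (\<Sum>i<2. scale ((-1) ^ i * ((of_int n :: complex) gchoose i))
          (Y u (n - int i) (Y v (-2 + int i) vac)
           - scale ((-1) powi n) (Y v (n + -2 - int i) (Y u (int i) vac))))"
    unfolding T_def iterate[of u n v "-2" vac]
    by (rule Sum_any_upto) (auto simp: creation(2))
  also have "\<dots> = Y u n (T v) - scale (of_int n) (Y u (n - 1) v)"
    using creation(1)[of v] by (simp add: creation(2) numeral_2_eq_2 T_def)
  finally show ?thesis .
qed

lemma Y_T: "Y (T v) n w = - scale (of_int n) (Y v (n - 1) w)"
proof -
  let ?g = "\<lambda>i::nat. scale (of_nat (i + 1))
          (Y v (-2 - int i) (Y vac (n + int i) w)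
           - Y vac (-2 + n - int i) (Y v (int i) w))"
  have *: "Y (T v) n w = Sum_any ?g"
    unfolding T_def iterate[of v "-2" vac n w]
    using gchoose_minus2 by (simp add: power_int_def)
  \<comment> \<open>The vacuum has only the mode -1: the first summand survives at
    \<open>i = -1 - n\<close> for \<open>n < 0\<close>, the second at \<open>i = n - 1\<close> for
    \<open>n > 0\<close>. For \<open>n = 0\<close> nothing survives, and \<open>nat\<close> picks
    the index 0, where the term is 0 as well.\<close>
  have "?g i = 0" if "i \<noteq> nat (if n < 0 then -1 - n else n - 1)" for i
    using that by (auto simp: vacuum)
  then have "Sum_any ?g = ?g (nat (if n < 0 then -1 - n else n - 1))"
    by (rule Sum_any_single)
  also have "\<dots> = - scale (of_int n) (Y v (n - 1) w)"
  proof -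
    consider "n < 0" | "n = 0" | "n > 0" by linarith
    then show ?thesis
    proof cases
      case 1
      then have "of_nat (nat (-1 - n) + 1) = - (of_int n :: complex)"
        by (simp add: of_nat_nat)
      moreover have "-2 - (-1 - n) = n - 1" by simp
      ultimately show ?thesis using 1 by (simp add: vacuum)
    next
      case 2 then show ?thesis by (simp add: vacuum)
    next
      case 3
      then have "of_nat (nat (n - 1) + 1) = (of_int n :: complex)"
        by (simp add: of_nat_nat)
      then show ?thesis using 3 by (simp add: vacuum)
    qed
  qed
  finally show ?thesis using * by simp
qed

section \<open>Semi-conformal vectors\<close>

lemma vac_zero_imp: "vac = 0 \<Longrightarrow> (v::'v) = 0"
  using vacuum[of "-1" v] by simp

text \<open>The witness is the line spanned by the vacuum, with central charge 0: all of it has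
  weight 0, and every nonnegative mode annihilates it.\<close>

lemma zero_in_Sc: "0 \<in> Sc \<omega>"
proof -
  have vacs: "x \<in> span {vac} \<longleftrightarrow> (\<exists>c. x = scale c vac)" for x
    by (auto simp: span_singleton)
  have sub: "vertex_subalgebra (span {vac})"
    unfolding vertex_subalgebra_def
  proof (intro conjI ballI allI)
    fix u v n assume "u \<in> span {vac}" "v \<in> span {vac}"
    then obtain c d where "u = scale c vac" "v = scale d vac" unfolding vacs by blast
    then show "Y u n v \<in> span {vac}"
      by (simp add: Y_linear vacuum span_scale span_base span_zero)
  qed (auto simp: span_base subspace_span)
  have w: "weight_space (span {vac}) 0 n = (if n = 0 then span {vac} else {0})" for n
    by (auto simp: weight_space_def vir_def span_zero)
  have "voa_on (span {vac}) 0"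
    unfolding voa_on_def
  proof (intro conjI)
    show "\<exists>c. \<forall>m n. \<forall>u\<in>span {vac}. vir 0 m (vir 0 n u) - vir 0 n (vir 0 m u) =
           scale (of_int (m - n)) (vir 0 (m + n) u) +
           (if m + n = 0 then scale (of_int (m ^ 3 - m) / 12 * c) u else 0)"
      by (intro exI[of _ 0]) (simp add: vir_def)
    show "\<forall>u\<in>span {vac}. vir 0 (- 1) u = Y u (- 2) vac"
      by (auto simp: vacs vir_def Y_linear vacuum)
    have "(\<Union>n. weight_space (span {vac}) 0 n) = span {vac}"
      by (auto simp: w span_zero split: if_splits)
    then show "span {vac} = span (\<Union>n. weight_space (span {vac}) 0 n)"
      by (simp add: span_span)
    show "\<forall>n. \<exists>B. finite B \<and> weight_space (span {vac}) 0 n = span B"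
      unfolding w by (metis finite.emptyI finite.insertI span_empty)
    show "\<exists>N. \<forall>n<N. weight_space (span {vac}) 0 n = {0}"
      unfolding w by (intro exI[of _ 0]) auto
  qed (use sub in \<open>auto simp: span_zero\<close>)
  moreover have "\<forall>n\<ge>0. \<forall>u\<in>span {vac}. Y 0 n u = Y \<omega> n u"
    by (auto simp: vacs Y_linear creation(2))
  ultimately show ?thesis unfolding Sc_def by blast
qed

lemma Sc_equations:
  assumes "x \<in> Sc \<omega>"
  shows "Y \<omega> 1 x = scale 2 x" "Y \<omega> 2 x = 0" "Y x 1 x = scale 2 x"
proof -
  obtain U where U: "voa_on U x" and eq: "\<And>n u. n \<ge> 0 \<Longrightarrow> u \<in> U \<Longrightarrow> Y x n u = Y \<omega> n u"
    using assms unfolding Sc_def by blast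
  have xU: "x \<in> U" and vU: "vac \<in> U"
    using U by (auto simp: voa_on_def vertex_subalgebra_def)
  have "\<exists>c. \<forall>m n. \<forall>u\<in>U. vir x m (vir x n u) - vir x n (vir x m u)
        = scale (of_int (m - n)) (vir x (m + n) u)
          + (if m + n = 0 then scale (of_int (m ^ 3 - m) / 12 * c) u else 0)"
    using U unfolding voa_on_def by (elim conjE)
  then obtain c where c: "\<And>m n. vir x m (vir x n vac) - vir x n (vir x m vac)
        = scale (of_int (m - n)) (vir x (m + n) vac)
          + (if m + n = 0 then scale (of_int (m ^ 3 - m) / 12 * c) vac else 0)"
    using vU by meson
  \<comment> \<open>Here \<open>vir x (-2) vac\<close> is \<open>x\<close>. The brackets of L(0) and
    L(1) with L(-2), evaluated on the vacuum, give L(0)x = 2x and L(1)x = 3 L(-1)1 = 0; the central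
    term is absent from both.\<close>
  show 1: "Y x 1 x = scale 2 x"
    using c[of 0 "-2"] by (simp add: vir_def creation)
  have 2: "Y x 2 x = 0"
    using c[of 1 "-2"] by (simp add: vir_def creation)
  show "Y \<omega> 1 x = scale 2 x" "Y \<omega> 2 x = 0"
    using eq[of 1 x] eq[of 2 x] xU 1 2 by auto
qed

section \<open>Decomposition into weight spaces\<close>

lemma subspace_weight_space: "subspace (weight_space UNIV \<omega> n)"
  by (auto simp: subspace_def weight_space_def vir_def Y_linear scale_right_distrib mult.commute)

text \<open>Eigenvectors for distinct eigenvalues are independent: L(0) - j removes the summand of
  index \<open>j\<close> and multiplies each other one by the nonzero number
  \<open>n - j\<close>.\<close>

lemma weight_sum_zero:
  assumes "finite F" "\<And>n. n \<in> F \<Longrightarrow> g n \<in> weight_space UNIV \<omega> n" "(\<Sum>n\<in>F. g n) = 0"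
  shows "\<forall>n\<in>F. g n = 0"
  using assms
proof (induction F arbitrary: g rule: finite_induct)
  case (insert j F)
  have L: "Y \<omega> 1 (g n) = scale (of_int n) (g n)" if "n \<in> insert j F" for n
    using insert.prems(1)[OF that] by (simp add: weight_space_def vir_def)
  have "(\<Sum>n\<in>F. scale (of_int (n - j)) (g n))
      = Y \<omega> 1 (\<Sum>n\<in>insert j F. g n) - scale (of_int j) (\<Sum>n\<in>insert j F. g n)"
    using insert.hyps
    by (simp add: Y_add_right Y_sum_right L scale_sum_right scale_left_diff_distrib
          sum_subtractf scale_right_distrib)
  then have "(\<Sum>n\<in>F. scale (of_int (n - j)) (g n)) = 0"
    unfolding insert.prems(2) by simp
  moreover have "scale (of_int (n - j)) (g n) \<in> weight_space UNIV \<omega> n" if "n \<in> F" for n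
    using L[of n] that by (simp add: weight_space_def vir_def Y_scale_right mult.commute)
  ultimately have "\<forall>n\<in>F. scale (of_int (n - j)) (g n) = 0"
    by (intro insert.IH)
  then have "\<forall>n\<in>F. g n = 0" using insert.hyps(2) by auto
  then show ?case using insert by auto
qed auto

text \<open>Turns a spanning family of homogeneous vectors into a description of each single weight
  space.\<close>

lemma weight_component:
  assumes sub: "\<And>n. subspace (V n)" "\<And>n. V n \<subseteq> weight_space UNIV \<omega> n"
    and x: "x \<in> span (\<Union>n. V n)" "x \<in> weight_space UNIV \<omega> k"
  shows "x \<in> V k"
proof -
  have "\<exists>F g. finite F \<and> (\<forall>n. g n \<in> V n) \<and> (\<forall>n. n \<notin> F \<longrightarrow> g n = 0) \<and> x = (\<Sum>n\<in>F. g n)"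
    using x(1)
  proof (induction rule: span_induct_alt)
    case base
    show ?case by (intro exI[of _ "{}"] exI[of _ "\<lambda>_. 0"]) (simp add: sub(1) subspace_0)
  next
    case (step c y z)
    obtain F g where Fg: "finite F" "\<forall>n. g n \<in> V n" "\<forall>n. n \<notin> F \<longrightarrow> g n = 0" "z = (\<Sum>n\<in>F. g n)"
      using step by blast
    obtain m where m: "y \<in> V m" using step by blast
    let ?g = "g(m := scale c y + g m)"
    have "scale c y + z = (\<Sum>n\<in>insert m F. ?g n)"
    proof -
      have "z = (\<Sum>n\<in>insert m F. g n)"
        using Fg by (cases "m \<in> F") (auto simp: insert_absorb)
      also have "\<dots> = g m + (\<Sum>n\<in>F - {m}. g n)"
        using Fg(1) by (simp add: sum.insert_remove)
      finally have "z = g m + (\<Sum>n\<in>F - {m}. g n)" .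
      moreover have "(\<Sum>n\<in>insert m F. ?g n) = ?g m + (\<Sum>n\<in>F - {m}. ?g n)"
        using Fg(1) by (simp only: sum.insert_remove)
      moreover have "(\<Sum>n\<in>F - {m}. ?g n) = (\<Sum>n\<in>F - {m}. g n)"
        by (intro sum.cong) auto
      ultimately show ?thesis by (simp add: add.assoc)
    qed
    then show ?case
      using Fg m sub(1)
      by (intro exI[of _ "insert m F"] exI[of _ ?g]) (auto simp: subspace_add subspace_scale)
  qed
  then obtain F g where Fg: "finite F" "\<And>n. g n \<in> V n" "\<And>n. n \<notin> F \<Longrightarrow> g n = 0"
    "x = (\<Sum>n\<in>F. g n)" by blast
  \<comment> \<open>Subtracting \<open>x\<close> from its component of index \<open>k\<close> gives
    a vanishing sum of weight vectors, so \<open>g k = x\<close>.\<close>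
  let ?g = "g(k := g k - x)"
  have "(\<Sum>n\<in>insert k F. ?g n) = 0"
  proof -
    have "x = (\<Sum>n\<in>insert k F. g n)"
      using Fg by (cases "k \<in> F") (auto simp: insert_absorb)
    also have "\<dots> = g k + (\<Sum>n\<in>F - {k}. g n)"
      using Fg(1) by (simp add: sum.insert_remove)
    finally have "x = g k + (\<Sum>n\<in>F - {k}. g n)" .
    moreover have "(\<Sum>n\<in>insert k F. ?g n) = ?g k + (\<Sum>n\<in>F - {k}. ?g n)"
      using Fg(1) by (simp only: sum.insert_remove)
    moreover have "(\<Sum>n\<in>F - {k}. ?g n) = (\<Sum>n\<in>F - {k}. g n)"
      by (intro sum.cong) auto
    ultimately show ?thesis by simp
  qed
  moreover have "?g n \<in> weight_space UNIV \<omega> n" for n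
    using subsetD[OF sub(2) Fg(2)[of n]] subspace_diff[OF subspace_weight_space _ x(2)]
    by (cases "n = k") auto
  ultimately have "?g k = 0"
    using weight_sum_zero[of "insert k F" ?g \<omega>] Fg(1) by (meson finite_insert insertI1)
  then show ?thesis using Fg(2)[of k] by simp
qed

end

section \<open>Vertex algebras generated by level 1 currents\<close>

text \<open>Stated for an abstract vertex algebra so that the universal algebra and its simple
  quotient are both instances. Each product is listed in both orders, as the commutator formula is
  used with either factor first.\<close>

locale affine_sl2_level1 = vertex_algebra scale Y vac
  for scale :: "complex \<Rightarrow> 'v::ab_group_add \<Rightarrow> 'v" and Y vac +
  fixes e f h :: 'v
  assumes ee: "i \<ge> 0 \<Longrightarrow> Y e i e = 0"
    and ff: "i \<ge> 0 \<Longrightarrow> Y f i f = 0"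
    and hh: "i \<ge> 0 \<Longrightarrow> Y h i h = (if i = 1 then scale 2 vac else 0)"
    and he: "i \<ge> 0 \<Longrightarrow> Y h i e = (if i = 0 then scale 2 e else 0)"
    and eh: "i \<ge> 0 \<Longrightarrow> Y e i h = (if i = 0 then scale (-2) e else 0)"
    and hf: "i \<ge> 0 \<Longrightarrow> Y h i f = (if i = 0 then scale (-2) f else 0)"
    and fh: "i \<ge> 0 \<Longrightarrow> Y f i h = (if i = 0 then scale 2 f else 0)"
    and ef: "i \<ge> 0 \<Longrightarrow> Y e i f = (if i = 0 then h else if i = 1 then vac else 0)"
    and fe: "i \<ge> 0 \<Longrightarrow> Y f i e = (if i = 0 then - h else if i = 1 then vac else 0)"
    and generated: "subspace S \<Longrightarrow> vac \<in> S \<Longrightarrow>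
        (\<And>a n x. a \<in> {e, f, h} \<Longrightarrow> x \<in> S \<Longrightarrow> Y a n x \<in> S) \<Longrightarrow> S = UNIV"
begin

section \<open>Commutation relations of the currents\<close>

text \<open>Only the products of index 0 and 1 enter the commutator formula; the second is a
  multiple of the vacuum, whose modes produce the central term.\<close>

lemma gen_comm:
  assumes "\<And>i. i \<ge> 2 \<Longrightarrow> Y a i b = 0" "Y a 1 b = scale k vac"
  shows "Y a m (Y b n x) = Y b n (Y a m x) + Y (Y a 0 b) (m + n) x
           + (if m + n = 0 then scale (of_int m * k) x else 0)"
proof -
  have "Y a m (Y b n x) - Y b n (Y a m x)
    = (\<Sum>i<2. scale ((of_int m :: complex) gchoose i) (Y (Y a (int i) b) (m + n - int i) x))"
    by (rule commutator_upto) (simp add: assms)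
  also have "\<dots> = Y (Y a 0 b) (m + n) x + (if m + n = 0 then scale (of_int m * k) x else 0)"
    by (simp add: numeral_2_eq_2 assms Y_linear vacuum)
  finally show ?thesis by (simp add: algebra_simps)
qed

lemma comm:
  "Y e m (Y e n x) = Y e n (Y e m x)"
  "Y f m (Y f n x) = Y f n (Y f m x)"
  "Y h m (Y h n x) = Y h n (Y h m x) + (if m + n = 0 then scale (of_int m * 2) x else 0)"
  "Y h m (Y e n x) = Y e n (Y h m x) + scale 2 (Y e (m + n) x)"
  "Y e m (Y h n x) = Y h n (Y e m x) - scale 2 (Y e (m + n) x)"
  "Y h m (Y f n x) = Y f n (Y h m x) - scale 2 (Y f (m + n) x)"
  "Y f m (Y h n x) = Y h n (Y f m x) + scale 2 (Y f (m + n) x)"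
  "Y e m (Y f n x) = Y f n (Y e m x) + Y h (m + n) x + (if m + n = 0 then scale (of_int m) x else 0)"
  "Y f m (Y e n x) = Y e n (Y f m x) - Y h (m + n) x + (if m + n = 0 then scale (of_int m) x else 0)"
  using gen_comm[of e e 0 m n x] gen_comm[of f f 0 m n x] gen_comm[of h h 2 m n x]
    gen_comm[of h e 0 m n x] gen_comm[of e h 0 m n x] gen_comm[of h f 0 m n x]
    gen_comm[of f h 0 m n x] gen_comm[of e f 1 m n x] gen_comm[of f e 1 m n x]
  by (simp_all add: ee ff hh he eh hf fh ef fe Y_linear)

lemmas ope = ee ff hh he eh hf fh ef fe

text \<open>A uniform weakening of \<open>comm\<close>, for arguments in which only membership in a
  subspace matters.\<close>

lemma comm_span:
  assumes "a \<in> {e, f, h}" "b \<in> {e, f, h}"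
  shows "Y a m (Y b n x) - Y b n (Y a m x)
    \<in> span {Y e (m + n) x, Y f (m + n) x, Y h (m + n) x, if m + n = 0 then x else 0}"
    (is "_ \<in> span ?S")
proof -
  have "y \<in> ?S \<Longrightarrow> scale k y \<in> span ?S" for k y
    by (intro span_scale span_base)
  from this[of "Y e (m + n) x" 2] this[of "Y h (m + n) x" 1] this[of "Y f (m + n) x" 2]
    this[of "if m + n = 0 then x else 0"]
  show ?thesis
    using assms by (auto simp: comm[of m n x] span_zero span_neg span_add span_diff)
qed

lemma gen_induct [case_names subspace vac step]:
  assumes "subspace {x. P x}" "P vac" "\<And>a n x. a \<in> {e, f, h} \<Longrightarrow> P x \<Longrightarrow> P (Y a n x)"
  shows "P v"
  using generated[of "{x. P x}"] assms by blast

section \<open>The Sugawara vector and the Virasoro relations\<close>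

text \<open>The Sugawara vector in the dual bases \<open>h\<close>, \<open>e\<close>,
  \<open>f\<close> and \<open>h/2\<close>, \<open>f\<close>, \<open>e\<close>; the factor 1/6 is
  1/(2(level + 2)) at level 1.\<close>

definition \<omega> :: 'v where
  "\<omega> = scale (1/6) (scale (1/2) (Y h (-1) h) + Y e (-1) f + Y f (-1) e)"

text \<open>This fixes the normalization: for \<open>i = 1\<close> the central terms contribute 2a
  and the brackets, through the adjoint Casimir, 4a, which makes 6a.\<close>

lemma gen_omega:
  assumes "a \<in> {e, f, h}" "i \<ge> 0"
  shows "Y a i \<omega> = (if i = 1 then a else 0)"
proof -
  have "scale 6 (Y a i \<omega>) = scale (1/2) (Y a i (Y h (-1) h)) + Y a i (Y e (-1) f) + Y a i (Y f (-1) e)"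
    by (simp add: \<omega>_def Y_linear)
  also have "\<dots> = scale 6 (if i = 1 then a else 0)"
  proof -
    consider "i = 0" | "i = 1" | "i \<ge> 2" using assms(2) by linarith
    then show ?thesis
    proof cases
      case 1
      then show ?thesis using assms(1)
        by (auto simp: comm[of 0 "-1"] ope Y_linear creation(1) algebra_simps)
    next
      case 2
      have "x + scale k x = scale (1 + k) x" for x k
        by (simp add: scale_left_distrib)
      with 2 show ?thesis using assms(1)
        by (auto simp: comm[of 1 "-1"] ope Y_linear creation(1) algebra_simps simp flip: scale_left_distrib)
    next
      case 3
      then show ?thesis using assms(1)
        by (auto simp: comm[of i "-1"] ope Y_linear creation algebra_simps)
    qed
  qed
  finally show ?thesis by simp
qed

text \<open>The commutator formula is applied with \<open>a\<close> as the first factor, because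
  \<open>gen_omega\<close> supplies the products of \<open>a\<close> with
  \<open>\<omega>\<close>.\<close>

lemma omega_comm:
  assumes "a \<in> {e, f, h}"
  shows "Y \<omega> m (Y a n x) = Y a n (Y \<omega> m x) - scale (of_int n) (Y a (m + n - 1) x)"
proof -
  have "Y a n (Y \<omega> m x) - Y \<omega> m (Y a n x)
    = (\<Sum>i<2. scale ((of_int n :: complex) gchoose i) (Y (Y a (int i) \<omega>) (n + m - int i) x))"
    by (rule commutator_upto) (use assms in \<open>auto simp: gen_omega\<close>)
  also have "\<dots> = scale (of_int n) (Y a (m + n - 1) x)"
    using assms by (simp add: numeral_2_eq_2 gen_omega add.commute)
  finally show ?thesis by (simp add: algebra_simps)
qed

text \<open>Both operators kill the vacuum and have the same commutators with the modes of the
  generators.\<close>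

lemma omega_0: "Y \<omega> 0 v = T v"
proof (induction v rule: gen_induct)
  case subspace
  show ?case by (auto simp: subspace_def Y_linear T_def)
next
  case (step a n x)
  then show ?case by (simp only: omega_comm T_Y) simp
qed (simp add: creation T_vac)

lemma omega_gen:
  assumes "a \<in> {e, f, h}" "i \<ge> 0"
  shows "Y \<omega> i a = (if i = 0 then Y a (-2) vac else if i = 1 then a else 0)"
  using omega_comm[of a i "-1" vac] assms by (auto simp: creation)

text \<open>The third product is c/2 times the vacuum, with central charge c = 3 level/(level + 2) =
  1.\<close>

lemma omega_omega:
  "Y \<omega> 1 \<omega> = scale 2 \<omega>" "Y \<omega> 2 \<omega> = 0" "Y \<omega> 3 \<omega> = scale (1/2) vac"
  "i \<ge> 4 \<Longrightarrow> Y \<omega> i \<omega> = 0"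
proof -
  have *: "scale 6 (Y \<omega> i \<omega>) = scale (1/2) (Y \<omega> i (Y h (-1) h)) + Y \<omega> i (Y e (-1) f) + Y \<omega> i (Y f (-1) e)" for i
    by (subst (2) \<omega>_def) (simp add: Y_linear)
  have c: "Y \<omega> m (Y a (-1) b) = Y a (-1) (Y \<omega> m b) + Y a (m - 2) b" if "a \<in> {e, f, h}" for a b m
    using omega_comm[OF that, of m "-1" b] by simp
  have half: "scale (1/2) x + scale (1/2) x = x" for x
    by (simp flip: scale_left_distrib)
  have "scale 6 (Y \<omega> 1 \<omega>) = scale 6 (scale 2 \<omega>)"
    unfolding * by (simp add: c omega_gen) (simp add: \<omega>_def algebra_simps scale_2 half)
  then show "Y \<omega> 1 \<omega> = scale 2 \<omega>" by (rule scale_left_imp_eq[rotated]) simp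
  have "scale 6 (Y \<omega> 2 \<omega>) = 0"
    unfolding * by (simp add: c omega_gen ope)
  then show "Y \<omega> 2 \<omega> = 0" by simp
  have "scale 3 vac = vac + vac + vac"
    using scale_left_distrib[of 2 1 vac] by (simp add: scale_2)
  then have "scale 6 (Y \<omega> 3 \<omega>) = scale 6 (scale (1/2) vac)"
    unfolding * by (simp add: c omega_gen ope flip: scale_left_distrib) 
  then show "Y \<omega> 3 \<omega> = scale (1/2) vac" by (rule scale_left_imp_eq[rotated]) simp
  assume "i \<ge> 4"
  then have "scale 6 (Y \<omega> i \<omega>) = 0"
    unfolding * by (simp add: c omega_gen ope)
  then show "Y \<omega> i \<omega> = 0" by simp
qed

lemma virasoro:
  "vir \<omega> m (vir \<omega> n u) - vir \<omega> n (vir \<omega> m u)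
    = scale (of_int (m - n)) (vir \<omega> (m + n) u)
      + (if m + n = 0 then scale (of_int (m ^ 3 - m) / 12 * 1) u else 0)"
proof -
  \<comment> \<open>This coefficient of the third product, times 1/2, is the central term (m^3 -
    m)/12.\<close>
  have g: "(of_int (m + 1) :: complex) gchoose 3 = of_int (m ^ 3 - m) / 6"
    by (simp add: gbinomial_prod_rev numeral_3_eq_3 fact_reduce power_def algebra_simps)
  define G where "G i = scale ((of_int (m + 1) :: complex) gchoose i)
      (Y (Y \<omega> (int i) \<omega>) (m + 1 + (n + 1) - int i) u)" for i
  have G: "G 0 = Y (T \<omega>) (m + n + 2) u" "G 1 = scale (of_int (m + 1) * 2) (Y \<omega> (m + n + 1) u)"
    "G 2 = 0" "G 3 = scale (of_int (m ^ 3 - m) / 6 * (1/2)) (Y vac (m + n - 1) u)"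
    using omega_0[of \<omega>] unfolding G_def g by (simp_all add: omega_omega Y_linear algebra_simps)
  have "vir \<omega> m (vir \<omega> n u) - vir \<omega> n (vir \<omega> m u) = (\<Sum>i<4. G i)"
    unfolding vir_def G_def by (rule commutator_upto) (simp add: omega_omega)
  also have "\<dots> = G 0 + G 1 + G 2 + G 3"
    by (simp add: numeral_eq_Suc)
  also have "\<dots> = Y (T \<omega>) (m + n + 2) u + scale (of_int (m + 1) * 2) (Y \<omega> (m + n + 1) u)
      + scale (of_int (m ^ 3 - m) / 6 * (1/2)) (Y vac (m + n - 1) u)"
    by (simp only: G add_0_right)
  also have "\<dots> = scale (of_int (m - n)) (vir \<omega> (m + n) u)
      + (if m + n = 0 then scale (of_int (m ^ 3 - m) / 12 * 1) u else 0)"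
  proof -
    \<comment> \<open>The part m + n + 2 cancels against the mode of \<open>T \<omega>\<close>,
      leaving m - n.\<close>
    have k: "of_int (m + 1) * 2 = (of_int (m - n) + of_int (m + n + 2) :: complex)"
      by simp
    have "m + n + 2 - 1 = m + n + 1" "m + n - 1 = -1 \<longleftrightarrow> m + n = 0" by auto
    then show ?thesis
      unfolding k scale_left_distrib Y_T vir_def vacuum by (simp add: add.commute[of 1])
  qed
  finally show ?thesis .
qed


section \<open>Words in negative modes and finiteness of weight spaces\<close>

text \<open>\<open>word N j x\<close>: a product of negative modes of total weight \<open>j\<close>, applied to an element of \<open>N\<close>, gives \<open>x\<close>.\<close>

inductive word :: "'v set \<Rightarrow> nat \<Rightarrow> 'v \<Rightarrow> bool" for N where
  base: "x \<in> N \<Longrightarrow> word N 0 x"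
| step: "word N j x \<Longrightarrow> a \<in> {e, f, h} \<Longrightarrow> word N (j + Suc k) (Y a (- 1 - int k) x)"

definition word_span :: "'v set \<Rightarrow> 'v set" where
  "word_span N = span {x. \<exists>j. word N j x}"

lemma word_span_base: "word N j x \<Longrightarrow> x \<in> word_span N"
  unfolding word_span_def by (rule span_base) blast

lemma word_span_closed_neg:
  assumes "a \<in> {e, f, h}" "n < 0" "x \<in> word_span N"
  shows "Y a n x \<in> word_span N"
proof (rule Y_span_right[OF assms(3)[unfolded word_span_def]])
  fix x assume "x \<in> {x. \<exists>j. word N j x}"
  then obtain j where "word N j x" by blast
  from word.step[OF this assms(1), of "nat (- 1 - n)"] show "Y a n x \<in> word_span N"
    using assms(2) by (auto intro: word_span_base)
qed (simp add: word_span_def subspace_span)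

text \<open>A mode is moved to the right through the word. Each commutator is a combination of modes
  acting on a shorter word, and a nonnegative mode that reaches \<open>N\<close> is absorbed by the
  hypothesis.\<close>

lemma word_span_closed:
  assumes N: "\<And>a n x. a \<in> {e, f, h} \<Longrightarrow> n \<ge> 0 \<Longrightarrow> x \<in> N \<Longrightarrow> Y a n x \<in> span N"
    and a: "a \<in> {e, f, h}" and x: "x \<in> word_span N"
  shows "Y a m x \<in> word_span N"
proof (rule Y_span_right[OF x[unfolded word_span_def]])
  have sub: "subspace (word_span N)" by (simp add: word_span_def subspace_span)
  have "\<forall>a\<in>{e, f, h}. \<forall>m. Y a m x \<in> word_span N" if "word N j x" for j x
    using that
  proof induction
    case (base x)
    have "N \<subseteq> word_span N"
      using word_span_base word.base by blast
    then have "span N \<subseteq> word_span N"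
      using sub by (rule span_minimal)
    then show ?case
      using N[OF _ _ base] word_span_closed_neg[OF _ _ word_span_base[OF word.base[OF base]]]
      by (meson linorder_not_less subsetD)
  next
    case (step j x b k)
    show ?case
    proof (intro ballI allI)
      fix a m assume a: "a \<in> {e, f, h}"
      let ?n = "- 1 - int k"
      have "span {Y e (m + ?n) x, Y f (m + ?n) x, Y h (m + ?n) x, if m + ?n = 0 then x else 0}
          \<subseteq> word_span N"
        using step.IH word_span_base[OF step.hyps(1)] subspace_0[OF sub]
        by (intro span_minimal sub) auto
      then have "Y a m (Y b ?n x) - Y b ?n (Y a m x) \<in> word_span N"
        using comm_span[OF a step.hyps(2), of m ?n x] by blast
      moreover have "Y b ?n (Y a m x) \<in> word_span N"
        using step.IH a by (intro word_span_closed_neg[OF step.hyps(2)]) auto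
      ultimately show "Y a m (Y b ?n x) \<in> word_span N"
        using subspace_add[OF sub] by fastforce
    qed
  qed
  then show "Y a m x \<in> word_span N" if "x \<in> {x. \<exists>j. word N j x}" for x
    using a that by blast
qed (simp add: word_span_def subspace_span)

lemma weight_space_gen:
  assumes "a \<in> {e, f, h}" "x \<in> weight_space UNIV \<omega> k"
  shows "Y a n x \<in> weight_space UNIV \<omega> (k - n)"
  using assms omega_comm[OF assms(1), of 1 n x]
  by (simp add: weight_space_def vir_def Y_scale_right scale_left_diff_distrib)

lemma word_weight:
  assumes "word N j x" "N \<subseteq> weight_space UNIV \<omega> k"
  shows "x \<in> weight_space UNIV \<omega> (k + int j)"
  using assms
proof induction
  case (step j x a i)
  then show ?case using weight_space_gen[of a x "k + int j" "- 1 - int i"] by (simp add: algebra_simps)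
qed auto

text \<open>The outermost factor of a word of weight \<open>j\<close> is a mode \<open>i - j\<close>
  of a generator, where \<open>i < j\<close> is the weight of the rest; this leaves finitely many
  choices.\<close>

lemma finite_word:
  assumes "finite N"
  shows "finite {x. word N j x}"
proof (induction j rule: less_induct)
  case (less j)
  have "{x. word N j x} \<subseteq> N \<union> (\<Union>i<j. \<Union>a\<in>{e, f, h}. Y a (int i - int j) ` {x. word N i x})"
  proof clarify
    fix x assume "word N j x" "x \<notin> (\<Union>i<j. \<Union>a\<in>{e, f, h}. Y a (int i - int j) ` {x. word N i x})"
    then show "x \<in> N"
    proof cases
      case (step i y a k)
      then have "x = Y a (int i - int j) y" by simp
      then have "x \<in> (\<Union>i<j. \<Union>a\<in>{e, f, h}. Y a (int i - int j) ` {x. word N i x})"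
        using step by (intro UN_I[of i] UN_I[of a]) auto
      then show ?thesis using \<open>x \<notin> _\<close> by contradiction
    qed
  qed
  moreover have "finite (N \<union> (\<Union>i<j. \<Union>a\<in>{e, f, h}. Y a (int i - int j) ` {x. word N i x}))"
    using assms less by auto
  ultimately show ?case by (rule finite_subset)
qed

lemma vac_weight: "vac \<in> weight_space UNIV \<omega> 0"
  by (simp add: weight_space_def vir_def creation)

lemma word_span_vac: "word_span {vac} = UNIV"
proof (rule generated)
  show "subspace (word_span {vac})" by (simp add: word_span_def subspace_span)
  show "vac \<in> word_span {vac}" by (auto intro: word_span_base word.base)
  show "Y a n x \<in> word_span {vac}" if "a \<in> {e, f, h}" "x \<in> word_span {vac}" for a n x
    using that by (rule word_span_closed[rotated]) (auto simp: creation(2) span_zero)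
qed

text \<open>Words are homogeneous and together span everything, so \<open>weight_component\<close>
  gives the harder inclusion. The case distinction is there because \<open>nat\<close> would send
  negative weights to 0.\<close>

lemma weight_space_eq:
  "weight_space UNIV \<omega> n = span (if n < 0 then {} else {x. word {vac} (nat n) x})"
proof
  define V where "V n = span (if n < 0 then {} else {x. word {vac} (nat n) x})" for n
  have VW: "V n \<subseteq> weight_space UNIV \<omega> n" for n
    unfolding V_def using word_weight[of "{vac}" "nat n" _ 0] vac_weight
    by (intro span_minimal subspace_weight_space) auto
  then show "span (if n < 0 then {} else {x. word {vac} (nat n) x}) \<subseteq> weight_space UNIV \<omega> n"
    unfolding V_def .
  have "{x. \<exists>j. word {vac} j x} \<subseteq> (\<Union>n. V n)"
  proof clarify
    fix x j assume "word {vac} j x"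
    then have "x \<in> V (int j)" unfolding V_def by (auto intro: span_base)
    then show "x \<in> (\<Union>n. V n)" by blast
  qed
  then have "span (\<Union>n. V n) = UNIV"
    using word_span_vac span_mono unfolding word_span_def by blast
  then show "weight_space UNIV \<omega> n \<subseteq> span (if n < 0 then {} else {x. word {vac} (nat n) x})"
    using weight_component[of V \<omega> _ n] VW by (auto simp: V_def subspace_span)
qed

lemma voa_on_UNIV: "voa_on UNIV \<omega>"
  unfolding voa_on_def
proof (intro conjI)
  show "vertex_subalgebra UNIV" by (simp add: vertex_subalgebra_def)
  show "\<exists>c. \<forall>m n. \<forall>u\<in>UNIV.
       vir \<omega> m (vir \<omega> n u) - vir \<omega> n (vir \<omega> m u) =
       scale (of_int (m - n)) (vir \<omega> (m + n) u) +
       (if m + n = 0 then scale (of_int (m ^ 3 - m) / 12 * c) u else 0)"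
    using virasoro by blast
  show "\<forall>u\<in>UNIV. vir \<omega> (- 1) u = Y u (- 2) vac"
    by (simp add: vir_def omega_0 T_def)
  have "{x. \<exists>j. word {vac} j x} \<subseteq> (\<Union>n. weight_space UNIV \<omega> n)"
    using word_weight[of "{vac}" _ _ 0] vac_weight by blast
  then show "UNIV = span (\<Union>n. weight_space UNIV \<omega> n)"
    using word_span_vac span_mono unfolding word_span_def by blast
  show "\<forall>n. \<exists>B. finite B \<and> weight_space UNIV \<omega> n = span B"
    unfolding weight_space_eq using finite_word by (metis finite.emptyI finite_insert)
  show "\<exists>N. \<forall>n<N. weight_space UNIV \<omega> n = {0}"
    unfolding weight_space_eq by (intro exI[of _ 0]) auto
qed simp

lemma omega_in_Sc: "\<omega> \<in> Sc \<omega>"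
  using voa_on_UNIV unfolding Sc_def by blast

section \<open>Ideals and singular vectors\<close>

text \<open>
  Translation reduces the closure under $w \mapsto w_n v$ to $w_{-1}\mathbf{1} = w$, so skew-symmetry
  is not needed.
\<close>

lemma va_idealI:
  assumes sub: "subspace I" and cl: "\<And>a n x. a \<in> {e, f, h} \<Longrightarrow> x \<in> I \<Longrightarrow> Y a n x \<in> I"
  shows "va_ideal I"
proof -
  have left: "\<forall>n. \<forall>x\<in>I. Y v n x \<in> I" for v
  proof (induction v rule: gen_induct)
    case subspace
    show ?case using sub by (auto simp: subspace_def Y_linear)
  next
    case vac
    show ?case using sub by (simp add: vacuum subspace_0)
  next
    case (step a l v)
    then show ?case unfolding iterate
      by (intro allI ballI Sum_any_in_subspace subspace_scale subspace_diff sub) (simp_all add: cl)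
  qed
  have vacn: "\<forall>w\<in>I. Y w (- 1 - int k) vac \<in> I" for k
  proof (induction k)
    case 0
    show ?case by (simp add: creation)
  next
    case (Suc k)
    show ?case
    proof
      fix w assume "w \<in> I"
      \<comment> \<open>Translation is the mode 0 of \<open>\<omega>\<close>, so it preserves
        \<open>I\<close>. On the vacuum the mode -1-k of \<open>T w\<close> is k+1 times the mode
        -2-k of \<open>w\<close>, and k+1 is invertible.\<close>
      then have "T w \<in> I" using left[of \<omega>] by (simp flip: omega_0)
      then have "scale (inverse (of_nat (Suc k))) (Y (T w) (- 1 - int k) vac) \<in> I"
        using Suc by (intro subspace_scale sub) auto
      moreover have "Y (T w) (- 1 - int k) vac = scale (of_nat (Suc k)) (Y w (- 1 - int (Suc k)) vac)"
      proof -
        have "(of_int (- 1 - int k) :: complex) = - of_nat (Suc k)" "- 1 - int k - 1 = - 1 - int (Suc k)"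
          by simp_all
        then show ?thesis unfolding Y_T by (simp only: scale_minus_left minus_minus)
      qed
      ultimately show "Y w (- 1 - int (Suc k)) vac \<in> I"
        by (simp del: of_nat_Suc)
    qed
  qed
  have right: "\<forall>n. \<forall>w\<in>I. Y w n v \<in> I" for v
  proof (induction v rule: gen_induct)
    case subspace
    show ?case using sub by (auto simp: subspace_def Y_linear)
  next
    case vac
    show ?case
    proof (intro allI ballI)
      fix n w assume w: "w \<in> I"
      show "Y w n vac \<in> I"
      proof (cases "n < 0")
        case True
        then show ?thesis using vacn[of "nat (- 1 - n)"] w by simp
      qed (simp add: creation sub subspace_0)
    qed
  next
    case (step a m v)
    show ?case
    proof (intro allI ballI)
      fix n w assume w: "w \<in> I"
      \<comment> \<open>The commutator consists of modes of the vectors \<open>Y a i w\<close>,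
        which lie in \<open>I\<close>, applied to \<open>v\<close>; the induction hypothesis covers
        them.\<close>
      have "Y a m (Y w n v) - Y w n (Y a m v) \<in> I"
        unfolding commutator
        using step left w by (intro Sum_any_in_subspace subspace_scale sub) simp
      moreover have "Y a m (Y w n v) \<in> I" using step w cl by blast
      ultimately show "Y w n (Y a m v) \<in> I"
        using subspace_diff[OF sub] by fastforce
    qed
  qed
  show ?thesis unfolding va_ideal_def using sub left right by blast
qed

text \<open>The ideal generated by a singular vector of weight \<open>k > 0\<close> misses the vacuum, having weights \<open>\<ge> k\<close>.\<close>

lemma singular_vector_zero:
  assumes simple: simple_va and k: "k > 0"
    and s: "s \<in> weight_space UNIV \<omega> k" "\<And>a n. a \<in> {e, f, h} \<Longrightarrow> n \<ge> 1 \<Longrightarrow> Y a n s = 0"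
  shows "s = 0"
proof -
  \<comment> \<open>All singular vectors of weight \<open>k\<close> are taken together, so that the
    zero modes of the generators preserve the set.\<close>
  define N where "N = {x \<in> weight_space UNIV \<omega> k. \<forall>a\<in>{e, f, h}. \<forall>n\<ge>1. Y a n x = 0}"
  have N0: "Y a 0 x \<in> N" if "a \<in> {e, f, h}" "x \<in> N" for a x
  proof -
    have "Y b n (Y a 0 x) = 0" if b: "b \<in> {e, f, h}" and n: "n \<ge> 1" for b n
    proof -
      have "Y b n (Y a 0 x) - Y a 0 (Y b n x) \<in> span {0}"
        using comm_span[OF b \<open>a \<in> _\<close>, of n 0 x] n \<open>x \<in> N\<close> by (simp add: N_def)
      then show ?thesis using b n \<open>x \<in> N\<close> by (auto simp: N_def)
    qed
    moreover have "Y a 0 x \<in> weight_space UNIV \<omega> k"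
      using weight_space_gen[of a x k 0] that by (simp add: N_def)
    ultimately show ?thesis by (simp add: N_def)
  qed
  have cl: "Y a n x \<in> word_span N" if "a \<in> {e, f, h}" "x \<in> word_span N" for a n x
    using _ that
  proof (rule word_span_closed)
    fix a n x assume *: "a \<in> {e, f, h}" "(n::int) \<ge> 0" "x \<in> N"
    show "Y a n x \<in> span N"
    proof (cases "n = 0")
      case True
      then show ?thesis using N0 * by (auto intro: span_base)
    next
      case False
      then have "Y a n x = 0" using * by (auto simp: N_def)
      then show ?thesis by (simp add: span_zero)
    qed
  qed
  have "va_ideal (word_span N)"
    using cl by (intro va_idealI) (auto simp: word_span_def subspace_span)
  then have "word_span N = {0} \<or> word_span N = UNIV"
    using simple unfolding simple_va_def by blast
  moreover have "word_span N \<noteq> UNIV"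
  proof
    assume U: "word_span N = UNIV"
    \<comment> \<open>Were the ideal everything, these spaces would span, and the vacuum, of weight
      0 < k, would lie in \<open>V 0 = {0}\<close>.\<close>
    define V where "V n = (if n \<ge> k then weight_space UNIV \<omega> n else {0})" for n
    have "{x. \<exists>j. word N j x} \<subseteq> (\<Union>n. V n)"
    proof clarify
      fix x j assume "word N j x"
      then have "x \<in> V (k + int j)" using word_weight[of N j x k] by (auto simp: V_def N_def)
      then show "x \<in> (\<Union>n. V n)" by blast
    qed
    then have "span (\<Union>n. V n) = UNIV"
      using U span_mono unfolding word_span_def by blast
    then have "vac \<in> V 0"
      using subspace_weight_space subspace_0[OF subspace_weight_space]
      by (intro weight_component[of V \<omega>] vac_weight) (auto simp: V_def)
    then have "vac = 0" using k by (simp add: V_def)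
    then show False using simple vac_zero_imp unfolding simple_va_def by blast
  qed
  moreover have "s \<in> word_span N"
    using s by (intro word_span_base[of _ 0] word.base) (auto simp: N_def)
  ultimately show ?thesis by auto
qed

section \<open>Relations in weight 2 of a simple algebra\<close>

text \<open>The vector is singular exactly because of the level: under f(1) it yields e from f(1)e =
  1, -2e from the bracket -h(0), and e from the central term, with sum 0.\<close>

lemma e_e_zero:
  assumes simple_va
  shows "Y e (-1) e = 0"
proof (rule singular_vector_zero[OF assms, of 2])
  have "e \<in> weight_space UNIV \<omega> 1"
    by (simp add: weight_space_def vir_def omega_gen)
  then show "Y e (-1) e \<in> weight_space UNIV \<omega> 2"
    using weight_space_gen[of e e 1 "-1"] by simp
  fix a n assume "a \<in> {e, f, h}" "(n::int) \<ge> 1"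
  moreover have "n = 1 \<or> n = 2 \<or> n \<ge> 3" using \<open>n \<ge> 1\<close> by linarith
  ultimately show "Y a n (Y e (-1) e) = 0"
    using comm[of n "-1" e] by (auto simp: ope creation scale_2)
qed simp

text \<open>Obtained from $e(-1)e = 0$ by applying $f(0)$ up to four times.\<close>

lemma simple_relations:
  assumes simple_va
  shows "Y h (-1) e = Y e (-2) vac" "Y e (-1) h = - Y e (-2) vac"
    "Y h (-1) h = scale 4 \<omega>" 
    "Y e (-1) f = scale 2 \<omega> + scale (1/2) (Y h (-2) vac)"
    "Y f (-1) e = scale 2 \<omega> - scale (1/2) (Y h (-2) vac)"
    "Y h (-1) f = - Y f (-2) vac" "Y f (-1) h = Y f (-2) vac" "Y f (-1) f = 0"
proof -
  note f0 = comm[of 0 "-1"] ope Y_linear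
  have half: "x = y" if "x + x = y + y" for x y :: 'v
    using that scale_left_imp_eq[of 2 x y] by (simp add: scale_2)
  have solve: "q = - t" if "p + q = 0" "p = q + scale 2 t" for p q t
  proof -
    have "scale 2 (q + t) = p + q" by (simp add: that(2) scale_2 add_ac)
    then show ?thesis using that(1) by (simp add: eq_neg_iff_add_eq_0)
  qed
  have e0: "Y e (-1) e = 0" using e_e_zero[OF assms] .
  have "Y f 0 (Y e (-1) e) = 0" by (simp add: e0)
  then have 1: "Y h (-1) e + Y e (-1) h = 0"
    by (simp add: f0 add_eq_0_iff add.commute)
  \<comment> \<open>Exchanging two modes -1 on the vacuum costs a vector a(-2)1; combined with the
    symmetric relations from f(0), this determines both orderings.\<close>
  have 2: "Y h (-1) e = Y e (-1) h + scale 2 (Y e (-2) vac)"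
    using comm(4)[of "-1" "-1" vac] by (simp add: creation)
  have 3: "Y e (-1) f = Y f (-1) e + Y h (-2) vac"
    using comm(8)[of "-1" "-1" vac] by (simp add: creation)
  have 4: "Y h (-1) f = Y f (-1) h - scale 2 (Y f (-2) vac)"
    using comm(6)[of "-1" "-1" vac] by (simp add: creation)
  show A: "Y e (-1) h = - Y e (-2) vac"
    by (rule solve[OF 1 2])
  then show B: "Y h (-1) e = Y e (-2) vac"
    using 1 by (simp add: add_eq_0_iff)
  \<comment> \<open>The second application of f(0), to both summands of relation 1.\<close>
  have "Y f 0 (Y h (-1) e) = scale 2 (Y f (-1) e) - Y h (-1) h"
    "Y f 0 (Y e (-1) h) = scale 2 (Y e (-1) f) - Y h (-1) h"
    by (simp_all add: f0)
  then have "(Y f (-1) e + Y e (-1) f + (Y f (-1) e + Y e (-1) f)) - (Y h (-1) h + Y h (-1) h)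
      = Y f 0 (Y h (-1) e + Y e (-1) h)"
    by (simp add: Y_add_right scale_2)
  also have "\<dots> = 0" by (simp only: 1 Y_zero_right)
  finally have 5: "Y h (-1) h = Y f (-1) e + Y e (-1) f"
    by - (rule half, simp)
  \<comment> \<open>The third application, to relation 5: with X = f(-1)h + h(-1)f it reads 2X =
    -X.\<close>
  have "Y f 0 (Y h (-1) h) = scale 2 (Y f (-1) h + Y h (-1) f)"
    "Y f 0 (Y f (-1) e) = - Y f (-1) h" "Y f 0 (Y e (-1) f) = - Y h (-1) f"
    by (simp_all add: f0 scale_right_distrib)
  then have "scale 2 (Y f (-1) h + Y h (-1) f) = - Y f (-1) h - Y h (-1) f"
    using arg_cong[OF 5, of "Y f 0"] by (simp add: Y_add_right)
  then have "scale 2 (Y f (-1) h + Y h (-1) f) + (Y f (-1) h + Y h (-1) f) = 0"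
    by simp
  then have "scale 3 (Y f (-1) h + Y h (-1) f) = 0"
    using scale_left_distrib[of 2 1 "Y f (-1) h + Y h (-1) f"] by simp
  then have 6: "Y f (-1) h + Y h (-1) f = 0" by simp
  show C: "Y h (-1) f = - Y f (-2) vac"
    by (rule solve[OF 6]) (simp add: 4)
  then show "Y f (-1) h = Y f (-2) vac"
    using 6 by simp
  \<comment> \<open>The fourth application.\<close>
  have "Y f 0 (Y f (-1) h + Y h (-1) f) = 0" using 6 by simp
  then have "scale 4 (Y f (-1) f) = 0"
    using scale_left_distrib[of 2 2 "Y f (-1) f"] by (simp add: f0)
  then show "Y f (-1) f = 0" by simp
  \<comment> \<open>By relation 5 the terms in e and f also add up to h(-1)h, so 6 times the
    Sugawara vector is (1/2 + 1) h(-1)h.\<close>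
  have "scale 6 \<omega> = scale (1/2) (Y h (-1) h) + (Y f (-1) e + Y e (-1) f)"
    by (simp add: \<omega>_def)
  also have "\<dots> = scale (3/2) (Y h (-1) h)"
    unfolding 5[symmetric] using scale_left_distrib[of "1/2" 1 "Y h (-1) h"] by simp
  finally have "scale (2/3) (scale 6 \<omega>) = scale (2/3) (scale (3/2) (Y h (-1) h))"
    by simp
  then show E: "Y h (-1) h = scale 4 \<omega>" by simp
  have "scale 4 \<omega> = Y f (-1) e + Y f (-1) e + Y h (-2) vac"
    using E 5 3 by (simp add: algebra_simps)
  then have "scale (1/2) (scale 4 \<omega>) = scale (1/2) (scale 2 (Y f (-1) e) + Y h (-2) vac)"
    by (simp add: scale_2)
  then have "scale 2 \<omega> = Y f (-1) e + scale (1/2) (Y h (-2) vac)"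
    by (simp add: scale_right_distrib)
  then show F: "Y f (-1) e = scale 2 \<omega> - scale (1/2) (Y h (-2) vac)"
    by simp
  show "Y e (-1) f = scale 2 \<omega> + scale (1/2) (Y h (-2) vac)"
    unfolding 3 F using scale_left_distrib[of "1/2" "1/2" "Y h (-2) vac"]
    by (simp add: algebra_simps)
qed

text \<open>A word of weight 2 on the vacuum is a(-2)1 or a(-1)b; the nine vectors of the second
  kind are rewritten by \<open>simple_relations\<close> and \<open>e_e_zero\<close>.\<close>

lemma weight_2:
  assumes simple_va
  shows "weight_space UNIV \<omega> 2 \<subseteq> span {\<omega>, Y e (-2) vac, Y f (-2) vac, Y h (-2) vac}"
    (is "_ \<subseteq> span ?S")
proof -
  have w1: "x \<in> {e, f, h}" if "word {vac} 1 x" for x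
    using that
  proof cases
    case (step j y a k)
    then have "j = 0" "k = 0" by auto
    with step have "word {vac} 0 y" by simp
    then have "y = vac" by cases auto
    with step \<open>k = 0\<close> show ?thesis by (auto simp: creation)
  qed simp
  have "x \<in> span ?S" if "word {vac} 2 x" for x
    using that
  proof cases
    case (step j y a k)
    then consider "j = 0" "k = 1" | "j = 1" "k = 0" by linarith
    then show ?thesis
    proof cases
      case 1
      with step have "word {vac} 0 y" by simp
      then have "y = vac" by cases auto
      with step 1 show ?thesis by (auto intro: span_base)
    next
      case 2
      with step w1 have y: "y \<in> {e, f, h}" by simp
      have S: "z \<in> span ?S" if "z \<in> ?S" for z
        using that by (rule span_base)
      have "Y a (-1) y \<in> span ?S"
        using y \<open>a \<in> _\<close> S
        by (auto simp: simple_relations[OF assms] e_e_zero[OF assms]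
            span_zero span_neg span_add span_diff span_scale)
      then show ?thesis using step 2 by simp
    qed
  qed simp
  then show ?thesis
    unfolding weight_space_eq by (intro span_minimal subspace_span) auto
qed

section \<open>Solving the equations for a semi-conformal vector\<close>

lemma idempotent_cases:
  assumes simple: simple_va
    and x: "Y \<omega> 1 x = scale 2 x" "Y \<omega> 2 x = 0" "Y x 1 x = scale 2 x"
  shows "x = 0 \<or> x = \<omega>"
proof -
  have "x \<in> span {\<omega>, Y e (-2) vac, Y f (-2) vac, Y h (-2) vac}"
    using weight_2[OF simple] x(1) by (auto simp: weight_space_def vir_def)
  then obtain c p q r where xeq:
    "x = scale c \<omega> + scale p (Y e (-2) vac) + scale q (Y f (-2) vac) + scale r (Y h (-2) vac)"
    by (auto simp: span_insert algebra_simps)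
  have d: "Y \<omega> 2 (Y a (-2) vac) = scale 2 a" if "a \<in> {e, f, h}" for a
    using omega_comm[OF that, of 2 "-2" vac] by (simp add: creation)
  \<comment> \<open>The part of \<open>x\<close> in the vectors a(-2)1 is
    \<open>Y y (-2) vac\<close>, and L(1) maps it to 2y, so L(1)x = 0 removes it as a whole.\<close>
  define y where "y = scale p e + scale q f + scale r h"
  have "Y \<omega> 2 x = scale 2 y"
    unfolding xeq y_def by (simp add: Y_linear omega_omega d algebra_simps)
  then have "y = 0" using x(2) by simp
  moreover have "x = scale c \<omega> + Y y (-2) vac"
    unfolding xeq y_def by (simp add: Y_linear)
  ultimately have xc: "x = scale c \<omega>" by simp
  have "scale (2 * (c * c)) \<omega> = scale (2 * c) \<omega>"
    using x(3) unfolding xc by (simp add: Y_linear omega_omega mult_ac)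
  \<comment> \<open>If the Sugawara vector itself vanishes, then so does \<open>x\<close>.\<close>
  then have "c * c = c \<or> \<omega> = 0" by simp
  then show ?thesis using xc by auto
qed

end

section \<open>The universal affine vertex algebra and its quotients\<close>

lemma lookup_map_smat: "Poly_Mapping.lookup (Poly_Mapping.map (smat c) p) n = smat c (Poly_Mapping.lookup p n)"
  by (simp add: Poly_Mapping.map.rep_eq when_def smat_def vec_eq_iff)

lemma zero_sl2: "0 \<in> sl2"
  by (simp add: sl2_def trace_def)

lemma lie_sl2: "lie a b \<in> sl2"
  using trace_mul_sym[of a b] by (simp add: lie_def sl2_def trace_sub)

lemma lie_swap: "lie b a = smat (-1) (lie a b)"
  by (simp add: lie_def smat_def vec_eq_iff)

lemma lie_same: "lie a a = smat 0 a"
  by (simp add: lie_def smat_def vec_eq_iff)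

lemma sl2_decompose:
  assumes "a \<in> sl2"
  shows "a = smat (a $ 1 $ 1) sl2_h + (smat (a $ 1 $ 2) sl2_e + smat (a $ 2 $ 1) sl2_f)"
  using assms
  by (auto simp: sl2_def trace_def sum_2 smat_def vec_eq_iff forall_2 sl2_h_def sl2_e_def sl2_f_def
      add_eq_0_iff)

lemma add_sl2: "a \<in> sl2 \<Longrightarrow> b \<in> sl2 \<Longrightarrow> a + b \<in> sl2"
  by (simp add: sl2_def trace_add)

lemma smat_sl2: "a \<in> sl2 \<Longrightarrow> smat c a \<in> sl2"
  by (simp add: sl2_def trace_def smat_def sum_distrib_left[symmetric])

lemma single_affine: "a \<in> sl2 \<Longrightarrow> (Poly_Mapping.single n a, k) \<in> affine_sl2"
  by (auto simp: affine_sl2_def lookup_single when_def zero_sl2)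

lemma loop_affine: "a \<in> sl2 \<Longrightarrow> loop a n \<in> affine_sl2"
  by (simp add: loop_def single_affine)

lemma central_affine: "(0, k) \<in> affine_sl2"
  by (simp add: affine_sl2_def zero_sl2)

lemma loop_add: "loop (a + b) n = loop a n + loop b n"
  by (simp add: loop_def single_add)

lemma loop_smat: "loop (smat c a) n = affine_scale c (loop a n)"
proof -
  have "smat c 0 = 0" by (simp add: smat_def vec_eq_iff)
  then have "Poly_Mapping.single n (smat c a) = Poly_Mapping.map (smat c) (Poly_Mapping.single n a)"
    by (intro poly_mapping_eqI) (simp add: lookup_map_smat lookup_single when_def)
  then show ?thesis by (simp add: loop_def affine_scale_def)
qed

lemma bracket_loop:
  "affine_bracket (loop a m) (loop b n)
    = (Poly_Mapping.single (m + n) (lie a b), if m + n = 0 then of_int m * form a b else 0)"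
proof -
  \<comment> \<open>A zero coefficient has empty support, which makes the bracket an empty sum; the
    right side must then vanish too.\<close>
  have "lie 0 b = 0" "lie a 0 = 0" "form 0 b = 0" "form a 0 = 0"
    by (simp_all add: lie_def form_def trace_def)
  then show ?thesis
    by (cases "a = 0"; cases "b = 0")
      (simp_all add: affine_bracket_def loop_def lookup_single zero_prod_def)
qed

lemma bracket_central: "affine_bracket (0, k) y = 0"
  by (simp add: affine_bracket_def)

lemma module_free_scale: "module free_scale"
proof -
  have l: "Poly_Mapping.lookup (free_scale c F) w = c * Poly_Mapping.lookup F w" for c F w
    by (simp add: free_scale_def Poly_Mapping.map.rep_eq when_def)
  show ?thesis
    by unfold_locales (auto intro!: poly_mapping_eqI simp: l lookup_add algebra_simps)
qed

section \<open>The affine action on the induced module\<close>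

locale universal_affine = vertex_algebra s Y vac
  for s :: "complex \<Rightarrow> 'v::ab_group_add \<Rightarrow> 'v" and Y vac +
  fixes level \<rho>
  assumes universal: "universal_affine_sl2 level s Y vac \<rho>"
begin

lemma
  shows rho_linear: "x \<in> affine_sl2 \<Longrightarrow> Vector_Spaces.linear s s (\<rho> x)"
    and rho_add: "x \<in> affine_sl2 \<Longrightarrow> y \<in> affine_sl2 \<Longrightarrow> \<rho> (x + y) v = \<rho> x v + \<rho> y v"
    and rho_scale: "x \<in> affine_sl2 \<Longrightarrow> \<rho> (affine_scale c x) v = s c (\<rho> x v)"
    and rho_bracket: "x \<in> affine_sl2 \<Longrightarrow> y \<in> affine_sl2 \<Longrightarrow>
      \<rho> (affine_bracket x y) v = \<rho> x (\<rho> y v) - \<rho> y (\<rho> x v)"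
  using universal by (simp_all add: universal_affine_sl2_def induced_module_def affine_rep_def)

lemma rho_loop: "a \<in> sl2 \<Longrightarrow> Y (\<rho> (loop a (-1)) vac) n v = \<rho> (loop a n) v"
  using universal by (simp add: universal_affine_sl2_def)

lemma word_action_superset:
  assumes "finite A" "Poly_Mapping.keys F \<subseteq> A"
  shows "word_action s \<rho> vac F = (\<Sum>w\<in>A. s (Poly_Mapping.lookup F w) (foldr \<rho> w vac))"
  unfolding word_action_def
  using assms by (intro sum.mono_neutral_left) (auto simp: in_keys_iff)

text \<open>This is the last family of \<open>induced_relations\<close> with empty prefix
  \<open>u\<close>, mapped to 0 by \<open>word_action\<close>.\<close>

lemma rho_nonneg_vac:
  assumes "x \<in> affine_nonneg"
  shows "\<rho> x vac = s (level * snd x) vac"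
proof -
  define F where "F = wmon [x] - free_scale (level * snd x) (wmon [])"
  have "F \<in> induced_relations level"
    unfolding induced_relations_def
    by (intro UnI2 CollectI exI[of _ "[]"] exI[of _ x]) (simp add: F_def assms)
  then have "F \<in> module.span free_scale (induced_relations level)"
    by (rule module.span_base[OF module_free_scale])
  then have 0: "word_action s \<rho> vac F = 0"
    using universal unfolding universal_affine_sl2_def induced_module_def by blast
  have l: "Poly_Mapping.lookup F w = (if w = [x] then 1 else if w = [] then - (level * snd x) else 0)" for w
    by (auto simp: F_def wmon_def free_scale_def lookup_minus lookup_single Poly_Mapping.map.rep_eq when_def)
  have "Poly_Mapping.keys F \<subseteq> {[x], []}"
    by (auto simp: in_keys_iff l split: if_splits)
  from word_action_superset[OF _ this] 0 show ?thesis by (simp add: l)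
qed

lemma rho_induct:
  assumes S: "subspace S" "vac \<in> S" and cl: "\<And>x v. x \<in> affine_sl2 \<Longrightarrow> v \<in> S \<Longrightarrow> \<rho> x v \<in> S"
  shows "S = UNIV"
proof -
  have w: "foldr \<rho> w vac \<in> S" if "set w \<subseteq> affine_sl2" for w
    using that by (induction w) (auto simp: S cl)
  have "word_action s \<rho> vac F \<in> S" if "F \<in> free_words" for F
    unfolding word_action_def using that w
    by (intro subspace_sum S subspace_scale) (auto simp: free_words_def)
  then have "word_action s \<rho> vac ` free_words \<subseteq> S"
    by (rule image_subsetI)
  moreover have "word_action s \<rho> vac ` free_words = UNIV"
    using universal by (simp add: universal_affine_sl2_def induced_module_def)
  ultimately show ?thesis by (simp add: top.extremum_unique)
qed

lemma rho_zero: "\<rho> 0 v = 0"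
  using rho_add[of 0 0 v] central_affine[of 0] by (simp add: zero_prod_def)

text \<open>The scalar is correct on the vacuum, and it propagates because a central element
  commutes with the whole action.\<close>

lemma rho_central: "\<rho> (0, k) v = s (level * k) v"
proof -
  interpret l: Vector_Spaces.linear s s "\<rho> (0, k)"
    by (rule rho_linear[OF central_affine])
  have "{v. \<rho> (0, k) v = s (level * k) v} = UNIV"
  proof (rule rho_induct)
    show "subspace {v. \<rho> (0, k) v = s (level * k) v}"
      by (auto simp: subspace_def l.add l.scale l.zero scale_right_distrib mult.commute)
    have "(0, k) \<in> affine_nonneg"
      using central_affine by (simp add: affine_nonneg_def)
    from rho_nonneg_vac[OF this] show "vac \<in> {v. \<rho> (0, k) v = s (level * k) v}"
      by simp
  next
    fix x v assume x: "x \<in> affine_sl2" and v: "v \<in> {v. \<rho> (0, k) v = s (level * k) v}"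
    interpret x: Vector_Spaces.linear s s "\<rho> x"
      by (rule rho_linear[OF x])
    have "\<rho> (0, k) (\<rho> x v) = \<rho> x (\<rho> (0, k) v)"
      using rho_bracket[OF central_affine x, of k v] by (simp add: bracket_central rho_zero)
    then show "\<rho> x v \<in> {v. \<rho> (0, k) v = s (level * k) v}"
      using v by (simp add: x.scale)
  qed
  then show ?thesis by blast
qed

section \<open>Currents of the universal algebra\<close>

definition J :: "cmat2 \<Rightarrow> 'v" where "J a = \<rho> (loop a (-1)) vac"

lemma Y_J: "a \<in> sl2 \<Longrightarrow> Y (J a) n v = \<rho> (loop a n) v"
  unfolding J_def by (rule rho_loop)

lemma J_add: "a \<in> sl2 \<Longrightarrow> b \<in> sl2 \<Longrightarrow> J (a + b) = J a + J b"
  by (simp add: J_def loop_add rho_add loop_affine)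

lemma J_smat: "a \<in> sl2 \<Longrightarrow> J (smat c a) = s c (J a)"
  by (simp add: J_def loop_smat rho_scale loop_affine)

text \<open>As a(i) kills the vacuum, only the bracket of a(i) with b(-1) acts on it. Its loop part
  has mode i - 1 and survives only for \<open>i = 0\<close>; its central part needs
  \<open>i = 1\<close>.\<close>

lemma J_ope:
  assumes a: "a \<in> sl2" and b: "b \<in> sl2" and i: "i \<ge> 0"
  shows "Y (J a) i (J b)
    = (if i = 0 then J (lie a b) else if i = 1 then s (level * form a b) vac else 0)"
proof -
  let ?k = "if i = 1 then of_int i * form a b else 0"
  interpret b: Vector_Spaces.linear s s "\<rho> (loop b (-1))"
    by (rule rho_linear[OF loop_affine[OF b]])
  have "\<rho> (loop a i) vac = 0"
    using creation(2)[OF i, of "J a"] by (simp add: Y_J a)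
  then have "Y (J a) i (J b) = \<rho> (affine_bracket (loop a i) (loop b (-1))) vac"
    unfolding rho_bracket[OF loop_affine[OF a] loop_affine[OF b]]
    by (simp add: Y_J a b.zero) (simp add: J_def)
  also have "affine_bracket (loop a i) (loop b (-1)) = loop (lie a b) (i - 1) + (0, ?k)"
    unfolding bracket_loop by (auto simp: loop_def)
  also have "\<rho> \<dots> vac = \<rho> (loop (lie a b) (i - 1)) vac + s (level * ?k) vac"
    by (simp add: rho_add loop_affine lie_sl2 central_affine rho_central)
  also have "\<rho> (loop (lie a b) (i - 1)) vac = (if i = 0 then J (lie a b) else 0)"
    using creation(2)[of "i - 1" "J (lie a b)"] i
    by (auto simp: Y_J lie_sl2) (simp add: J_def)
  finally show ?thesis by auto
qed

text \<open>An affine element is a finite sum of loops plus a central part: the loops act by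
  combinations of modes of the three currents, the central part by a scalar.\<close>

lemma generated_by_J:
  assumes S: "subspace S" "vac \<in> S"
    and cl: "\<And>a n x. a \<in> {J sl2_e, J sl2_f, J sl2_h} \<Longrightarrow> x \<in> S \<Longrightarrow> Y a n x \<in> S"
  shows "S = UNIV"
proof (rule rho_induct[OF S])
  fix x v assume x: "x \<in> affine_sl2" and v: "v \<in> S"
  have loop: "\<rho> (loop a n) v \<in> S" if a: "a \<in> sl2" for a n
  proof -
    have "J a = s (a $ 1 $ 1) (J sl2_h) + (s (a $ 1 $ 2) (J sl2_e) + s (a $ 2 $ 1) (J sl2_f))"
      by (subst (1) sl2_decompose[OF a]) (simp add: J_add J_smat sl2_mem add_sl2 smat_sl2)
    then have "Y (J a) n v \<in> S"
      using cl v S(1) by (simp add: Y_linear subspace_add subspace_scale)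
    then show ?thesis by (simp add: Y_J a)
  qed
  obtain p k where xp: "x = (p, k)" by (cases x)
  have p: "Poly_Mapping.lookup p n \<in> sl2" for n
    using x xp by (simp add: affine_sl2_def)
  have sums: "\<rho> (\<Sum>n\<in>A. Poly_Mapping.single n (Poly_Mapping.lookup p n), k) v \<in> S
      \<and> (\<Sum>n\<in>A. Poly_Mapping.single n (Poly_Mapping.lookup p n), k) \<in> affine_sl2"
    if "finite A" for A
    using that
  proof (induction A rule: finite_induct)
    case empty
    then show ?case using v S(1) by (simp add: rho_central central_affine subspace_scale)
  next
    case (insert n A)
    let ?q = "(\<Sum>n\<in>A. Poly_Mapping.single n (Poly_Mapping.lookup p n), k)"
    have eq: "(\<Sum>n\<in>insert n A. Poly_Mapping.single n (Poly_Mapping.lookup p n), k)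
        = loop (Poly_Mapping.lookup p n) n + ?q"
      using insert by (simp add: loop_def)
    have "loop (Poly_Mapping.lookup p n) n + ?q \<in> affine_sl2"
      using insert loop_affine[OF p, of n n]
      by (auto simp: affine_sl2_def loop_def lookup_add add_sl2)
    then show ?case unfolding eq
      using insert S(1) by (simp add: rho_add loop_affine p subspace_add loop)
  qed
  have "p = (\<Sum>n\<in>Poly_Mapping.keys p. Poly_Mapping.single n (Poly_Mapping.lookup p n))"
    by (rule poly_mapping_eqI) (simp add: lookup_sum lookup_single when_def in_keys_iff)
  then show "\<rho> x v \<in> S"
    using sums[of "Poly_Mapping.keys p"] xp by simp
qed

lemma affine_sl2_level1_J:
  assumes "level = 1"
  shows "affine_sl2_level1 s Y vac (J sl2_e) (J sl2_f) (J sl2_h)"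
proof unfold_locales
  have swap: "lie sl2_f sl2_e = smat (-1) sl2_h" "lie sl2_e sl2_h = smat (-1) (smat 2 sl2_e)"
    "lie sl2_f sl2_h = smat (-1) (smat (-2) sl2_f)"
    by (metis lie_swap sl2_lie)+
  note ope = J_ope J_smat sl2_mem smat_sl2 sl2_lie swap lie_same sl2_form assms
  fix i :: int assume "i \<ge> 0"
  then show "Y (J sl2_e) i (J sl2_e) = 0" "Y (J sl2_f) i (J sl2_f) = 0"
    "Y (J sl2_h) i (J sl2_h) = (if i = 1 then s 2 vac else 0)"
    "Y (J sl2_h) i (J sl2_e) = (if i = 0 then s 2 (J sl2_e) else 0)"
    "Y (J sl2_e) i (J sl2_h) = (if i = 0 then s (- 2) (J sl2_e) else 0)"
    "Y (J sl2_h) i (J sl2_f) = (if i = 0 then s (- 2) (J sl2_f) else 0)"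
    "Y (J sl2_f) i (J sl2_h) = (if i = 0 then s 2 (J sl2_f) else 0)"
    "Y (J sl2_e) i (J sl2_f) = (if i = 0 then J sl2_h else if i = 1 then vac else 0)"
    "Y (J sl2_f) i (J sl2_e) = (if i = 0 then - J sl2_h else if i = 1 then vac else 0)"
    by (simp_all add: ope)
qed (rule generated_by_J)

text \<open>In the sum over the orthonormal basis the terms e(-1)e and f(-1)f cancel between the
  first two vectors, and the mixed terms add up.\<close>

lemma sugawara_eq:
  assumes "level = 1"
  shows "sugawara level s vac \<rho>
    = affine_sl2_level1.\<omega> s Y (J sl2_e) (J sl2_f) (J sl2_h)"
proof -
  let ?e = "J sl2_e" and ?f = "J sl2_f" and ?h = "J sl2_h"
  \<comment> \<open>Only the squares of the normalizing factors enter; the one from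
    \<open>csqrt (-2)\<close> is negative, which causes the cancellation.\<close>
  have c: "(1 / csqrt 2) * (1 / csqrt 2) = 1/2" "(1 / csqrt (-2)) * (1 / csqrt (-2)) = -1/2"
    by (metis (no_types) divide_minus_right minus_divide_left mult_1 power2_csqrt power2_eq_square times_divide_times_eq)+
  have *: "\<rho> (loop (smat k a) (-1)) (\<rho> (loop (smat k a) (-1)) vac) = s (k * k) (Y (J a) (-1) (J a))"
    if "a \<in> sl2" for a k
  proof -
    have "\<rho> (loop (smat k a) (-1)) (\<rho> (loop (smat k a) (-1)) vac)
        = Y (J (smat k a)) (-1) (J (smat k a))"
      unfolding Y_J[OF smat_sl2[OF that]] by (simp only: J_def)
    then show ?thesis by (simp add: J_smat that Y_linear)
  qed
  have m: "sl2_e - sl2_f = sl2_e + smat (-1) sl2_f"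
    by (simp add: smat_def vec_eq_iff)
  have pm: "sl2_e + sl2_f \<in> sl2" "sl2_e - sl2_f \<in> sl2"
    by (simp_all add: m add_sl2 smat_sl2 sl2_mem)
  have J: "J (sl2_e + sl2_f) = ?e + ?f" "J (sl2_e - sl2_f) = ?e - ?f"
    unfolding m by (simp_all add: J_add J_smat smat_sl2 sl2_mem)
  have "(\<Sum>a\<leftarrow>sl2_onb. \<rho> (loop a (-1)) (\<rho> (loop a (-1)) vac))
      = s (1/2) (Y (?e + ?f) (-1) (?e + ?f)) + s (-1/2) (Y (?e - ?f) (-1) (?e - ?f))
        + s (1/2) (Y ?h (-1) ?h)"
    by (simp only: sl2_onb_def list.map sum_list.Cons sum_list.Nil * pm sl2_mem J c) (simp add: add.assoc)
  also have "\<dots> = s (1/2) (Y ?h (-1) ?h) + Y ?e (-1) ?f + Y ?f (-1) ?e"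
  proof -
    have half: "s (1/2) x + (s (1/2) x + y) = x + y" for x y
      by (simp flip: scale_left_distrib add.assoc)
    show ?thesis
      by (simp add: Y_linear algebra_simps half)
  qed
  finally show ?thesis
    unfolding sugawara_def affine_sl2_level1.\<omega>_def[OF affine_sl2_level1_J[OF assms]]
    by (simp add: assms)
qed

end

section \<open>Passage to the quotient\<close>

lemma affine_sl2_level1_image:
  assumes V: "affine_sl2_level1 s Y vac e f h" and L: "vertex_algebra s' Y' vac'"
    and hom: "va_hom s Y vac s' Y' vac' \<pi>" and surj: "surj \<pi>"
  shows "affine_sl2_level1 s' Y' vac' (\<pi> e) (\<pi> f) (\<pi> h)"
    and "\<pi> (affine_sl2_level1.\<omega> s Y e f h) = affine_sl2_level1.\<omega> s' Y' (\<pi> e) (\<pi> f) (\<pi> h)"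
proof -
  interpret V: affine_sl2_level1 s Y vac e f h by (rule V)
  interpret L: vertex_algebra s' Y' vac' by (rule L)
  interpret \<pi>: Vector_Spaces.linear s s' \<pi> using hom by (simp add: va_hom_def)
  have vac: "\<pi> vac = vac'" and Y: "\<And>u n v. Y' (\<pi> u) n (\<pi> v) = \<pi> (Y u n v)"
    using hom by (simp_all add: va_hom_def)
  show *: "affine_sl2_level1 s' Y' vac' (\<pi> e) (\<pi> f) (\<pi> h)"
  proof unfold_locales
    fix S assume S: "L.subspace S" "vac' \<in> S"
      and cl: "\<And>a n x. a \<in> {\<pi> e, \<pi> f, \<pi> h} \<Longrightarrow> x \<in> S \<Longrightarrow> Y' a n x \<in> S"
    \<comment> \<open>Generation descends by pulling a closed subspace back along
      \<open>\<pi>\<close>.\<close>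
    have "\<pi> -` S = UNIV"
    proof (rule V.generated)
      show "V.subspace (\<pi> -` S)"
        using S(1) by (auto simp: V.subspace_def L.subspace_def \<pi>.add \<pi>.scale \<pi>.zero)
      show "Y a n x \<in> \<pi> -` S" if "a \<in> {e, f, h}" "x \<in> \<pi> -` S" for a n x
        using cl[of "\<pi> a" "\<pi> x" n] that by (auto simp: Y)
    qed (simp add: S vac)
    then show "S = UNIV" using surj by (metis UNIV_I surjD vimageE UNIV_eq_I)
  qed (simp_all add: Y V.ope \<pi>.scale \<pi>.neg \<pi>.zero vac)
  show "\<pi> (V.\<omega>) = affine_sl2_level1.\<omega> s' Y' (\<pi> e) (\<pi> f) (\<pi> h)"
    unfolding V.\<omega>_def affine_sl2_level1.\<omega>_def[OF *] by (simp add: Y \<pi>.scale \<pi>.add)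
qed

theorem proposition4p3:
  fixes level :: complex
    and sV :: "complex \<Rightarrow> 'v::ab_group_add \<Rightarrow> 'v"
    and YV :: "'v \<Rightarrow> int \<Rightarrow> 'v \<Rightarrow> 'v" and vacV :: 'v
    and \<rho> :: "affine \<Rightarrow> 'v \<Rightarrow> 'v" and \<omega> :: 'v
    and sL :: "complex \<Rightarrow> 'w::ab_group_add \<Rightarrow> 'w"
    and YL :: "'w \<Rightarrow> int \<Rightarrow> 'w \<Rightarrow> 'w" and vacL :: 'w
    and \<pi> :: "'v \<Rightarrow> 'w"
  assumes "\<omega> = sugawara level sV vacV \<rho>"
    and "universal_affine_sl2 level sV YV vacV \<rho>"
    and "simple_quotient_map sV YV vacV sL YL vacL \<pi>"
    and "level = 1"
  shows "\<pi> ` vertex_algebra.Sc sV YV vacV \<omega> = vertex_algebra.Sc sL YL vacL (\<pi> \<omega>)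
    \<and> vertex_algebra.Sc sL YL vacL (\<pi> \<omega>) = {\<pi> \<omega>, 0}"
proof -
  have L: "vertex_algebra sL YL vacL" "vertex_algebra.simple_va sL YL"
    and hom: "va_hom sV YV vacV sL YL vacL \<pi>" and surj: "surj \<pi>"
    using assms(3) by (simp_all add: simple_quotient_map_def)
  interpret U: universal_affine sV YV vacV level \<rho>
    using assms(2) by (intro universal_affine.intro universal_affine_axioms.intro)
      (simp add: universal_affine_sl2_def)
  interpret V: affine_sl2_level1 sV YV vacV "U.J sl2_e" "U.J sl2_f" "U.J sl2_h"
    by (rule U.affine_sl2_level1_J[OF assms(4)])
  interpret L: affine_sl2_level1 sL YL vacL "\<pi> (U.J sl2_e)" "\<pi> (U.J sl2_f)" "\<pi> (U.J sl2_h)"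
    by (rule affine_sl2_level1_image(1)[OF V.affine_sl2_level1_axioms L(1) hom surj])
  interpret \<pi>: Vector_Spaces.linear sV sL \<pi> using hom by (simp add: va_hom_def)
  have Y: "\<And>u n v. YL (\<pi> u) n (\<pi> v) = \<pi> (YV u n v)"
    using hom by (simp add: va_hom_def)
  have \<omega>V: "\<omega> = V.\<omega>" using U.sugawara_eq assms(1,4) by simp
  have \<omega>L: "\<pi> \<omega> = L.\<omega>"
    unfolding \<omega>V by (rule affine_sl2_level1_image(2)[OF V.affine_sl2_level1_axioms L(1) hom surj])
  have "L.Sc (\<pi> \<omega>) = {\<pi> \<omega>, 0}"
    using L.Sc_equations L.idempotent_cases[OF L(2)] L.omega_in_Sc L.zero_in_Sc
    unfolding \<omega>L by blast
  moreover have "\<pi> ` U.Sc \<omega> = {\<pi> \<omega>, 0}"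
  proof
    show "\<pi> ` U.Sc \<omega> \<subseteq> {\<pi> \<omega>, 0}"
    proof (rule image_subsetI)
      fix x assume x: "x \<in> U.Sc \<omega>"
      have "YL (\<pi> \<omega>) 1 (\<pi> x) = sL 2 (\<pi> x)" "YL (\<pi> \<omega>) 2 (\<pi> x) = 0"
        "YL (\<pi> x) 1 (\<pi> x) = sL 2 (\<pi> x)"
        using U.Sc_equations[OF x] by (simp_all add: Y \<pi>.scale \<pi>.zero)
      then show "\<pi> x \<in> {\<pi> \<omega>, 0}"
        using L.idempotent_cases[OF L(2)] unfolding \<omega>L by blast
    qed
    \<comment> \<open>Both elements lift to semi-conformal vectors of the universal algebra, namely
      its own conformal vector and 0.\<close>
    show "{\<pi> \<omega>, 0} \<subseteq> \<pi> ` U.Sc \<omega>"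
      using V.omega_in_Sc U.zero_in_Sc[of \<omega>] \<pi>.zero unfolding \<omega>V
      by (metis (no_types) empty_subsetI image_eqI insert_subset)
  qed
  ultimately show ?thesis by simp
qed

end
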